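(* For every $k\geq3$, with $t=\frac{1}{2\sqrt{x}}$, $$\Phi_{21\mbox{-}3\mbox{-}\cdots\mbox{-}k}(x)=\frac{1}{4t^3U_k^2(t)}\left[\frac{U_2^2(t)}{U_3(t)}+\sum_{i=3}^{k-1}\frac{1}{U_i(t)U_{i+1}(t)}\left(\sum_{j=1}^{i}U_j^2(t)-2\right)\right].$$
   Context: A generalized pattern is a permutation of $\{1,\dots,k\}$ written as a word $\tau_1\cdots\tau_k$ in which each pair of adjacent letters may or may not be separated by a dash "-". An occurrence of $\tau$ in $\pi=\pi_1\cdots\pi_n\in S_n$ is a choice of indices $i_1<\dots<i_k$ with $(\pi_{i_1},\dots,\pi_{i_k})$ order-isomorphic to $(\tau_1,\dots,\tau_k)$ and $i_{j+1}=i_j+1$ whenever $\tau_j,\tau_{j+1}$ are not separated by a dash. $1\mbox{-}3\mbox{-}2$ is the classical pattern $132$. $\Phi_\tau(x)=\sum_{n\geq0}\varphi_\tau(n)x^n$ where $\varphi_\tau(n)$ is the number of permutations in $S_n$ having exactly one occurrence of $1\mbox{-}3\mbox{-}2$ and exactly one occurrence of $\tau$. $U_p$ is the Chebyshev polynomial of the second kind, $U_p(\cos\theta)=\sin((p+1)\theta)/\sin\theta$. *)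

theory Defs
  imports
    "HOL-Analysis.Analysis"
    "HOL-Combinatorics.Multiset_Permutations"
    "HOL-Computational_Algebra.Formal_Laurent_Series"
begin

text \<open>
  A generalized pattern is a pair (\<open>\<tau>\<close>, \<open>D\<close>) of a word \<open>\<tau>\<close> and the set \<open>D\<close> of those (0-based) positions \<open>j\<close>
  for which a dash separates the letters \<open>\<tau> ! j\<close> and \<open>\<tau> ! (j + 1)\<close>.
\<close>

type_synonym gen_pattern = "nat list \<times> nat set"

definition is_occurrence :: "gen_pattern \<Rightarrow> nat list \<Rightarrow> nat list \<Rightarrow> bool" where
  "is_occurrence p \<pi> is \<longleftrightarrow>
     (let \<tau> = fst p; D = snd p; k = length \<tau> in
        length is = k \<and>
        set is \<subseteq> {..<length \<pi>} \<and>
        sorted_wrt (<) is \<and>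
        (\<forall>a<k. \<forall>b<k. \<pi> ! (is ! a) < \<pi> ! (is ! b) \<longleftrightarrow> \<tau> ! a < \<tau> ! b) \<and>
        (\<forall>j. Suc j < k \<longrightarrow> j \<notin> D \<longrightarrow> is ! Suc j = Suc (is ! j)))"

definition occurrences :: "gen_pattern \<Rightarrow> nat list \<Rightarrow> nat list set" where
  "occurrences p \<pi> = {is. is_occurrence p \<pi> is}"

lemma finite_occurrences: "finite (occurrences p \<pi>)"
proof (rule finite_subset)
  show "occurrences p \<pi> \<subseteq> {is. set is \<subseteq> {..<length \<pi>} \<and> length is = length (fst p)}"
    by (auto simp: occurrences_def is_occurrence_def Let_def)
qed (rule finite_lists_length_eq, simp)

definition pattern_132 :: gen_pattern where
  "pattern_132 = ([1, 3, 2], {0, 1})"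

text \<open>The pattern 21-3-\<open>\<dots>\<close>-\<open>k\<close>, for \<open>k \<ge> 2\<close>: the only adjacent letters without a dash are 2 and 1.\<close>

definition pattern_21_3_to :: "nat \<Rightarrow> gen_pattern" where
  "pattern_21_3_to k = ([2, 1] @ [3..<k + 1], {1..<k - 1})"

definition \<phi> :: "gen_pattern \<Rightarrow> nat \<Rightarrow> nat" where
  "\<phi> p n = card {\<pi> \<in> permutations_of_set {1..n}.
     card (occurrences pattern_132 \<pi>) = 1 \<and> card (occurrences p \<pi>) = 1}"

definition \<Phi> :: "gen_pattern \<Rightarrow> real fps" where
  "\<Phi> p = Abs_fps (\<lambda>n. of_nat (\<phi> p n))"

definition chebyshev_U :: "nat \<Rightarrow> real poly" where
  "chebyshev_U p = (THE P. \<forall>\<theta>. sin \<theta> \<noteq> 0 \<longrightarrow> poly P (cos \<theta>) = sin (real (p + 1) * \<theta>) / sin \<theta>)"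

lemma chebyshev_U_unique:
  fixes P Q :: "real poly"
  assumes "\<And>\<theta>. sin \<theta> \<noteq> 0 \<Longrightarrow> poly P (cos \<theta>) = f \<theta>"
    and "\<And>\<theta>. sin \<theta> \<noteq> 0 \<Longrightarrow> poly Q (cos \<theta>) = f \<theta>"
  shows "P = Q"
proof (rule ccontr)
  assume "P \<noteq> Q"
  then have "finite {x. poly (P - Q) x = 0}"
    by (intro poly_roots_finite) simp
  moreover have "{-1<..<1} \<subseteq> {x. poly (P - Q) x = 0}"
  proof
    fix x :: real assume x: "x \<in> {-1<..<1}"
    then have "cos (arccos x) = x" and "sin (arccos x) \<noteq> 0"
      by (auto simp: sin_arccos_nonzero)
    then show "x \<in> {x. poly (P - Q) x = 0}"
      using assms[of "arccos x"] by simp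
  qed
  ultimately have "finite {-1<..<1::real}"
    using finite_subset by blast
  then show False
    by (simp add: infinite_Ioo)
qed

fun chebyshev_U_rec :: "nat \<Rightarrow> real poly" where
  "chebyshev_U_rec 0 = 1"
| "chebyshev_U_rec (Suc 0) = [:0, 2:]"
| "chebyshev_U_rec (Suc (Suc p)) = [:0, 2:] * chebyshev_U_rec (Suc p) - chebyshev_U_rec p"

lemma chebyshev_U_rec_cos: "poly (chebyshev_U_rec p) (cos \<theta>) * sin \<theta> = sin (real (p + 1) * \<theta>)"
proof (induction p rule: chebyshev_U_rec.induct)
  case (3 p)
  have "sin (real (Suc (Suc p) + 1) * \<theta>) + sin (real (p + 1) * \<theta>)
          = 2 * sin (real (Suc p + 1) * \<theta>) * cos \<theta>"
    using sin_add[of "real (Suc p + 1) * \<theta>" \<theta>] sin_diff[of "real (Suc p + 1) * \<theta>" \<theta>]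
    by (simp add: algebra_simps)
  with 3 show ?case
    by (simp add: algebra_simps)
qed (simp_all add: sin_double)

lemma chebyshev_U_eq_rec: "chebyshev_U p = chebyshev_U_rec p"
  unfolding chebyshev_U_def
proof (rule the_equality)
  show *: "\<forall>\<theta>. sin \<theta> \<noteq> 0 \<longrightarrow> poly (chebyshev_U_rec p) (cos \<theta>) = sin (real (p + 1) * \<theta>) / sin \<theta>"
    using chebyshev_U_rec_cos[of p] by (auto simp: field_simps)
  show "P = chebyshev_U_rec p"
    if "\<forall>\<theta>. sin \<theta> \<noteq> 0 \<longrightarrow> poly P (cos \<theta>) = sin (real (p + 1) * \<theta>) / sin \<theta>" for P
    using that * by (intro chebyshev_U_unique[of P "\<lambda>\<theta>. sin (real (p + 1) * \<theta>) / sin \<theta>"]) auto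
qed

lemma chebyshev_U_cos:
  "sin \<theta> \<noteq> 0 \<Longrightarrow> poly (chebyshev_U p) (cos \<theta>) = sin (real (p + 1) * \<theta>) / sin \<theta>"
  using chebyshev_U_rec_cos[of p \<theta>] by (simp add: chebyshev_U_eq_rec field_simps)

definition U :: "nat \<Rightarrow> real fls \<Rightarrow> real fls" where
  "U p t = poly (map_poly fls_const (chebyshev_U p)) t"

end

theory Submission
  imports Defs
begin

text \<open>
  Split a permutation at its maximum \<open>n\<close>. If it avoids 132, then it is \<open>L n R\<close> with every letter of \<open>L\<close>
  above every letter of \<open>R\<close> and both parts avoiding 132. If it has exactly one 132, then either it has
  this shape with the 132 inside \<open>L\<close> or inside \<open>R\<close>, or it is \<open>L' v n R\<close> with \<open>L'\<close> and \<open>R\<close> avoiding 132,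
  \<open>L'\<close> above everything else and \<open>R\<close> consisting of the letters \<open>1, \<dots>, v - 1, v + 1\<close>.
  Since an occurrence of \<open>21-3-\<dots>-k\<close> cannot straddle \<open>L\<close> and \<open>R\<close>, and can use \<open>n\<close> only as its last letter,
  the number of its occurrences in \<open>L n R\<close> is that in \<open>L\<close>, plus that in \<open>R\<close>, plus the number of
  occurrences of \<open>21-3-\<dots>-(k-1)\<close> in \<open>L\<close>. This gives linear recurrences in \<open>k\<close> for the four generating
  functions with zero or one occurrence of each pattern. With \<open>u\<^sub>i = x\<^bsup>i/2\<^esup> U\<^sub>i(t)\<close> they are solved by
  \<open>u\<^bsub>k-1\<^esub> / u\<^sub>k\<close>, \<open>x\<^sup>k / u\<^sub>k\<^sup>2\<close> and partial sums, the last step being the Cassini identity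
  \<open>u\<^bsub>k-1\<^esub>\<^sup>2 - u\<^bsub>k-2\<^esub> u\<^sub>k = x\<^bsup>k-1\<^esup>\<close>.
\<close>

subsection \<open>Counting occurrences\<close>

text \<open>Number of increasing subsequences of length \<open>m\<close> with all entries above
  \<open>v\<close>. They supply the letters 3, ..., k once \<open>v\<close> has been taken as the
  letter 2.\<close>

fun count_inc :: "nat \<Rightarrow> nat \<Rightarrow> nat list \<Rightarrow> nat" where
  "count_inc 0 v xs = 1"
| "count_inc (Suc m) v [] = 0"
| "count_inc (Suc m) v (y # ys) = (if v < y then count_inc m y ys else 0) + count_inc (Suc m) v ys"

text \<open>The index is shifted: \<open>count_21 m\<close> counts the occurrences of \<open>21-3-\<dots>-(m + 2)\<close>,
  so \<open>count_21 0\<close> counts descents.\<close>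

fun count_21 :: "nat \<Rightarrow> nat list \<Rightarrow> nat" where
  "count_21 m [] = 0"
| "count_21 m [a] = 0"
| "count_21 m (a # b # ys) = (if b < a then count_inc m a ys else 0) + count_21 m (b # ys)"

text \<open>The number of ways to complete \<open>a\<close>, taken as the letter 1, to an occurrence
  of 132.\<close>

fun pairs132 :: "nat \<Rightarrow> nat list \<Rightarrow> nat" where
  "pairs132 a [] = 0"
| "pairs132 a (y # ys) = length (filter (\<lambda>z. a < z \<and> z < y) ys) + pairs132 a ys"

fun count_132 :: "nat list \<Rightarrow> nat" where
  "count_132 [] = 0"
| "count_132 (a # ys) = pairs132 a ys + count_132 ys"

text \<open>Increasing index lists for \<open>y # ys\<close> either use the head or are shifted
  index lists for \<open>ys\<close>. This split matches the recursions of the counting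
  functions.\<close>

lemma sorted_nat_list_cases:
  assumes "sorted_wrt (<) (js :: nat list)"
  obtains ks where "js = map Suc ks" "sorted_wrt (<) ks"
  | ks where "js = 0 # map Suc ks" "sorted_wrt (<) ks"
proof -
  have pos: "\<exists>ks. ls = map Suc ks \<and> sorted_wrt (<) ks"
    if "sorted_wrt (<) ls" "0 \<notin> set ls" for ls :: "nat list"
  proof (intro exI conjI)
    show eq: "ls = map Suc (map (\<lambda>i. i - 1) ls)"
      using that(2) by (induction ls) auto
    show "sorted_wrt (<) (map (\<lambda>i. i - 1) ls)"
      using that(1) by (subst (asm) eq) (simp add: sorted_wrt_map)
  qed
  show ?thesis
  proof (cases "0 \<in> set js")
    case False
    with pos[OF assms] that(1) show ?thesis by blast
  next
    case True
    then obtain i ls where js: "js = i # ls" by (cases js) auto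
    with assms True have "i = 0" "0 \<notin> set ls" "sorted_wrt (<) ls" by auto
    with pos[of ls] js that(2) show ?thesis by blast
  qed
qed

text \<open>Prepending \<open>v\<close> to the selected entries merges the two demands, increasing
  order and lying above \<open>v\<close>, into a single chain.\<close>

definition count_inc_idx :: "nat \<Rightarrow> nat \<Rightarrow> nat list \<Rightarrow> nat list set" where
  "count_inc_idx m v xs = {js. length js = m \<and> set js \<subseteq> {..<length xs} \<and> sorted_wrt (<) js \<and>
     sorted_wrt (<) (v # map ((!) xs) js)}"

lemma finite_count_inc_idx: "finite (count_inc_idx m v xs)"
  by (rule finite_subset[OF _ finite_lists_length_eq[of "{..<length xs}" m]])
     (auto simp: count_inc_idx_def)

lemma count_inc_idx_Cons:
  "count_inc_idx (Suc m) v (y # ys) =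
     (if v < y then (\<lambda>js. 0 # map Suc js) ` count_inc_idx m y ys else {}) \<union>
     map Suc ` count_inc_idx (Suc m) v ys" (is "?L = ?R")
proof (intro equalityI subsetI)
  fix js assume js: "js \<in> ?L"
  then have "sorted_wrt (<) js" by (simp add: count_inc_idx_def)
  then show "js \<in> ?R"
  proof (cases rule: sorted_nat_list_cases)
    case (1 ks)
    with js have "ks \<in> count_inc_idx (Suc m) v ys"
      by (auto simp: count_inc_idx_def sorted_wrt_map)
    with 1 show ?thesis by auto
  next
    case (2 ks)
    with js have "ks \<in> count_inc_idx m y ys" "v < y"
      by (auto simp: count_inc_idx_def sorted_wrt_map)
    with 2 show ?thesis by auto
  qed
next
  fix js assume "js \<in> ?R"
  then show "js \<in> ?L"
    by (fastforce simp: count_inc_idx_def sorted_wrt_map split: if_splits)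
qed

lemma card_count_inc_idx: "card (count_inc_idx m v xs) = count_inc m v xs"
proof (induction m v xs rule: count_inc.induct)
  case (1 v xs)
  have "count_inc_idx 0 v xs = {[]}" by (auto simp: count_inc_idx_def)
  then show ?case by simp
next
  case (2 m v)
  have "count_inc_idx (Suc m) v [] = {}" by (auto simp: count_inc_idx_def)
  then show ?case by simp
next
  case (3 m v y ys)
  have inj: "inj_on (\<lambda>js. 0 # map Suc js) S" "inj_on (map Suc) S" for S
    by (auto simp: inj_on_def)
  have "0 # map Suc js \<notin> map Suc ` S" for js S by auto
  then have "(\<lambda>js. 0 # map Suc js) ` S \<inter> map Suc ` T = {}" for S T :: "nat list set"
    by blast
  then show ?case using 3
    by (simp add: count_inc_idx_Cons card_Un_disjoint finite_count_inc_idx card_image inj)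
qed

text \<open>The letters 3, ..., k exceed both 2 and 1, so order-isomorphism with the pattern amounts
  to one descent and one increasing chain that starts at the letter 2 and skips the letter
  1.\<close>

definition count_21_idx :: "nat \<Rightarrow> nat list \<Rightarrow> nat list set" where
  "count_21_idx m xs = {i # Suc i # js | i js. length js = m \<and>
     set (i # Suc i # js) \<subseteq> {..<length xs} \<and> sorted_wrt (<) (i # Suc i # js) \<and>
     xs ! Suc i < xs ! i \<and> sorted_wrt (<) (xs ! i # map ((!) xs) js)}"

lemma nth_pattern_21_3_to:
  "j < m + 2 \<Longrightarrow> fst (pattern_21_3_to (m + 2)) ! j = (if j = 0 then 2 else if j = 1 then 1 else j + 1)"
  by (auto simp: pattern_21_3_to_def nth_append nth_Cons' simp del: upt_Suc)

lemma length_pattern_21_3_to: "length (fst (pattern_21_3_to (m + 2))) = m + 2"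
  by (simp add: pattern_21_3_to_def del: upt_Suc)

lemma occurrences_pattern_21_3_to: "occurrences (pattern_21_3_to (m + 2)) xs = count_21_idx m xs"
proof (intro equalityI subsetI)
  fix ks assume "ks \<in> occurrences (pattern_21_3_to (m + 2)) xs"
  then have "is_occurrence (pattern_21_3_to (m + 2)) xs ks" by (simp add: occurrences_def)
  note occ' = this[unfolded is_occurrence_def Let_def length_pattern_21_3_to]
  have occ: "length ks = m + 2" "set ks \<subseteq> {..<length xs}" "sorted_wrt (<) ks"
    "\<And>a b. a < m + 2 \<Longrightarrow> b < m + 2 \<Longrightarrow> xs ! (ks ! a) < xs ! (ks ! b) \<longleftrightarrow>
       (if a = 0 then 2 else if a = 1 then 1 else a + 1) < (if b = 0 then 2 else if b = 1 then 1 else b + 1)"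
    "ks ! 1 = Suc (ks ! 0)"
  proof -
    show "xs ! (ks ! a) < xs ! (ks ! b) \<longleftrightarrow>
       (if a = 0 then 2 else if a = 1 then 1 else a + 1) < (if b = 0 then 2 else if b = 1 then 1 else b + 1)"
      if "a < m + 2" "b < m + 2" for a b
      using occ' that by (simp only: nth_pattern_21_3_to simp_thms)
    have "0 \<notin> snd (pattern_21_3_to (m + 2))" by (simp add: pattern_21_3_to_def)
    then show "ks ! 1 = Suc (ks ! 0)" using occ' by simp
  qed (use occ' in blast)+
  obtain i js where ks: "ks = i # Suc i # js" "length js = m"
    using occ(1,5) by (auto simp: length_Suc_conv)
  have "xs ! Suc i < xs ! i" using occ(4)[of 1 0] ks by simp
  moreover have "sorted_wrt (<) (xs ! i # map ((!) xs) js)"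
    unfolding sorted_wrt_iff_nth_less
  proof (intro allI impI)
    fix p q assume pq: "p < q" "q < length (xs ! i # map ((!) xs) js)"
    \<comment> \<open>Entry \<open>p\<close> of the chain sits at index \<open>0\<close> of the
      occurrence if \<open>p = 0\<close> and at index \<open>p + 1\<close> otherwise, because index
      \<open>1\<close> carries the letter 1.\<close>
    then show "(xs ! i # map ((!) xs) js) ! p < (xs ! i # map ((!) xs) js) ! q"
      using occ(4)[of "if p = 0 then 0 else p + 1" "q + 1"] ks
      by (auto simp: nth_Cons' split: if_splits)
  qed
  ultimately show "ks \<in> count_21_idx m xs"
    using occ ks unfolding count_21_idx_def by blast
next
  fix ks assume "ks \<in> count_21_idx m xs"
  then obtain i js where ks: "ks = i # Suc i # js" "length js = m" "set ks \<subseteq> {..<length xs}"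
    "sorted_wrt (<) ks" "xs ! Suc i < xs ! i" "sorted_wrt (<) (xs ! i # map ((!) xs) js)"
    unfolding count_21_idx_def by blast
  define \<tau> where "\<tau> j = (if j = 0 then 2 else if j = 1 then 1 else j + 1)" for j :: nat
  have less: "xs ! (ks ! a) < xs ! (ks ! b)" if "a < m + 2" "b < m + 2" "\<tau> a < \<tau> b" for a b
  proof -
    have A: "(xs ! i # map ((!) xs) js) ! p < (xs ! i # map ((!) xs) js) ! q"
      if "p < q" "q < m + 1" for p q
      using ks(2,6) that by (auto simp only: sorted_wrt_iff_nth_less length_Cons length_map)
    have B: "xs ! i < xs ! (js ! (b - 2))" if "b \<ge> 2"
      using A[of 0 "b - 1"] that ks(2) \<open>b < m + 2\<close> by (auto simp: nth_Cons' numeral_2_eq_2)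
    have C: "xs ! (js ! (a - 2)) < xs ! (js ! (b - 2))" if "a \<ge> 2" "b \<ge> 2" "a < b"
      using A[of "a - 1" "b - 1"] that ks(2) \<open>b < m + 2\<close> by (auto simp: nth_Cons' numeral_2_eq_2)
    show ?thesis
      using that B C ks(1,5) by (auto simp: \<tau>_def nth_Cons' numeral_2_eq_2 split: if_splits)
  qed
  \<comment> \<open>By injectivity distinct indices carry strictly comparable letters, so the
    reverse implication is \<open>less\<close> with the two indices exchanged.\<close>
  have "inj \<tau>" by (auto simp: inj_on_def \<tau>_def split: if_splits)
  then have iff: "xs ! (ks ! a) < xs ! (ks ! b) \<longleftrightarrow> \<tau> a < \<tau> b" if "a < m + 2" "b < m + 2" for a b
    using less[of a b] less[of b a] that by (metis injD less_asym' linorder_neqE_nat)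
  have D: "snd (pattern_21_3_to (m + 2)) = {1..<m + 1}" by (simp add: pattern_21_3_to_def)
  have "is_occurrence (pattern_21_3_to (m + 2)) xs ks"
    unfolding is_occurrence_def Let_def length_pattern_21_3_to D
  proof (intro conjI allI impI)
    fix a b assume "a < m + 2" "b < m + 2"
    then show "xs ! (ks ! a) < xs ! (ks ! b) \<longleftrightarrow>
      fst (pattern_21_3_to (m + 2)) ! a < fst (pattern_21_3_to (m + 2)) ! b"
      by (simp only: iff nth_pattern_21_3_to \<tau>_def)
  next
    fix j assume "Suc j < m + 2" "j \<notin> {1..<m + 1}"
    then have "j = 0" by auto
    then show "ks ! Suc j = Suc (ks ! j)" using ks(1) by simp
  qed (use ks in auto)
  then show "ks \<in> occurrences (pattern_21_3_to (m + 2)) xs" by (simp add: occurrences_def)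
qed

text \<open>If the head is used, it is the letter 2, adjacency forces \<open>b\<close> to be the
  letter 1, and the remaining indices form a chain above \<open>a\<close> in \<open>ys\<close>,
  shifted by two.\<close>

lemma count_21_idx_Cons:
  "count_21_idx m (a # b # ys) =
     (if b < a then (\<lambda>js. 0 # 1 # map (Suc \<circ> Suc) js) ` count_inc_idx m a ys else {}) \<union>
     map Suc ` count_21_idx m (b # ys)" (is "?L = ?R")
proof (intro equalityI subsetI)
  fix ks assume ks: "ks \<in> ?L"
  then have "sorted_wrt (<) ks" by (auto simp: count_21_idx_def)
  then show "ks \<in> ?R"
  proof (cases rule: sorted_nat_list_cases)
    case (1 ls)
    with ks obtain i js where "ls = i # Suc i # js"
      by (auto simp: count_21_idx_def Cons_eq_map_conv)
    with 1 ks have "ls \<in> count_21_idx m (b # ys)"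
      by (auto simp: count_21_idx_def sorted_wrt_map)
    with 1 show ?thesis by auto
  next
    case (2 ls)
    with ks obtain js where js: "ls = 0 # js"
      by (auto simp: count_21_idx_def map_eq_Cons_conv Cons_eq_map_conv)
    with 2 have "sorted_wrt (<) js" "0 \<notin> set js" by auto
    then obtain hs where hs: "js = map Suc hs"
      by (cases rule: sorted_nat_list_cases[of js]) auto
    have "hs \<in> count_inc_idx m a ys" "b < a"
      using ks 2 js hs by (auto simp: count_21_idx_def count_inc_idx_def sorted_wrt_map)
    with 2 js hs show ?thesis by auto
  qed
next
  fix ks assume "ks \<in> ?R"
  then show "ks \<in> ?L"
    by (auto simp: count_inc_idx_def count_21_idx_def sorted_wrt_map split: if_splits)
qed

lemma finite_count_21_idx: "finite (count_21_idx m xs)"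
  using finite_occurrences occurrences_pattern_21_3_to by metis

lemma card_count_21_idx: "card (count_21_idx m xs) = count_21 m xs"
proof (induction m xs rule: count_21.induct)
  case (1 m)
  have "count_21_idx m [] = {}" by (auto simp: count_21_idx_def)
  then show ?case by simp
next
  case (2 m a)
  have "count_21_idx m [a] = {}" by (auto simp: count_21_idx_def)
  then show ?case by simp
next
  case (3 m a b ys)
  have inj: "inj_on (\<lambda>js. 0 # Suc 0 # map (Suc \<circ> Suc) js) S" "inj_on (map Suc) S" for S
    by (auto simp: inj_on_def intro: map_injective[of "Suc \<circ> Suc"])
  have "0 # js \<notin> map Suc ` S" for js S by auto
  then have "(\<lambda>js. 0 # Suc 0 # map (Suc \<circ> Suc) js) ` S \<inter> map Suc ` T = {}" for S T :: "nat list set"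
    by blast
  then show ?case using 3
    by (simp add: count_21_idx_Cons card_Un_disjoint finite_count_inc_idx finite_count_21_idx card_image inj
        card_count_inc_idx)
qed

lemma card_occurrences_pattern_21_3_to:
  "card (occurrences (pattern_21_3_to (m + 2)) xs) = count_21 m xs"
  by (simp only: occurrences_pattern_21_3_to card_count_21_idx)

lemma mem_occurrences_pattern_132:
  "ks \<in> occurrences pattern_132 xs \<longleftrightarrow>
     (\<exists>i j l. ks = [i, j, l] \<and> i < j \<and> j < l \<and> l < length xs \<and> xs ! i < xs ! l \<and> xs ! l < xs ! j)"
proof -
  have all3: "(\<forall>a<Suc (Suc (Suc 0)). Q a) \<longleftrightarrow> Q 0 \<and> Q 1 \<and> Q 2" for Q :: "nat \<Rightarrow> bool"
    by (auto simp: numeral_2_eq_2 less_Suc_eq)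
  have "is_occurrence pattern_132 xs [i, j, l] \<longleftrightarrow>
      i < j \<and> j < l \<and> l < length xs \<and> xs ! i < xs ! l \<and> xs ! l < xs ! j" for i j l
    unfolding is_occurrence_def pattern_132_def Let_def
    by (simp add: all3) linarith
  moreover have "\<exists>i j l. ks = [i, j, l]" if "is_occurrence pattern_132 xs ks"
    using that by (auto simp: is_occurrence_def pattern_132_def Let_def length_Suc_conv)
  ultimately show ?thesis unfolding occurrences_def mem_Collect_eq by metis
qed

definition pairs132_idx :: "nat \<Rightarrow> nat list \<Rightarrow> (nat \<times> nat) set" where
  "pairs132_idx a ys = {p. fst p < snd p \<and> snd p < length ys \<and> a < ys ! snd p \<and> ys ! snd p < ys ! fst p}"

lemma finite_pairs132_idx: "finite (pairs132_idx a ys)"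
  by (rule finite_subset[of _ "{..<length ys} \<times> {..<length ys}"]) (auto simp: pairs132_idx_def)

lemma card_pairs132_idx: "card (pairs132_idx a ys) = pairs132 a ys"
proof (induction ys)
  case Nil
  have "pairs132_idx a [] = {}" by (auto simp: pairs132_idx_def)
  then show ?case by simp
next
  case (Cons y ys)
  define F where "F = {l. l < length ys \<and> a < ys ! l \<and> ys ! l < y}"
  have "finite F" by (rule finite_subset[of _ "{..<length ys}"]) (auto simp: F_def)
  have "pairs132_idx a (y # ys) = (\<lambda>l. (0, Suc l)) ` F \<union> map_prod Suc Suc ` pairs132_idx a ys"
    (is "?L = ?R")
  proof (intro equalityI subsetI)
    fix p assume "p \<in> ?L"
    then obtain j l where p: "p = (j, Suc l)" "j < Suc l" "l < length ys"
        "a < ys ! l" "ys ! l < (y # ys) ! j"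
      by (cases p; cases "snd p") (auto simp: pairs132_idx_def)
    show "p \<in> ?R"
    proof (cases j)
      case 0
      with p show ?thesis by (simp add: F_def)
    next
      case (Suc j')
      with p have "p = map_prod Suc Suc (j', l)" "(j', l) \<in> pairs132_idx a ys"
        by (auto simp: pairs132_idx_def)
      then show ?thesis by blast
    qed
  qed (auto simp: pairs132_idx_def F_def)
  also have "card \<dots> = card ((\<lambda>l. (0::nat, Suc l)) ` F) + card (map_prod Suc Suc ` pairs132_idx a ys)"
    using finite_pairs132_idx \<open>finite F\<close> by (intro card_Un_disjoint) auto
  also have "\<dots> = card F + card (pairs132_idx a ys)"
    by (intro arg_cong2[of _ _ _ _ "(+)"] card_image) (auto simp: inj_on_def)
  also have "card F = length (filter (\<lambda>z. a < z \<and> z < y) ys)"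
    by (simp add: F_def length_filter_conv_card)
  finally show ?case using Cons by simp
qed

lemma card_occurrences_pattern_132: "card (occurrences pattern_132 xs) = count_132 xs"
proof (induction xs)
  case Nil
  have "occurrences pattern_132 [] = {}" by (auto simp: mem_occurrences_pattern_132)
  then show ?case by simp
next
  case (Cons a ys)
  let ?O = "occurrences pattern_132"
  let ?f = "\<lambda>p. [0, Suc (fst p), Suc (snd p)]"
  have "?O (a # ys) = ?f ` pairs132_idx a ys \<union> map Suc ` ?O ys" (is "?L = ?R")
  proof (intro equalityI subsetI)
    fix ks assume "ks \<in> ?L"
    then obtain i j l where ks: "ks = [i, j, l]" "i < j" "j < l" "l < length (a # ys)"
      "(a # ys) ! i < (a # ys) ! l" "(a # ys) ! l < (a # ys) ! j"
      by (auto simp: mem_occurrences_pattern_132)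
    then obtain j' l' where jl: "j = Suc j'" "l = Suc l'" by (cases j; cases l) auto
    show "ks \<in> ?R"
    proof (cases i)
      case 0
      with ks jl have "(j', l') \<in> pairs132_idx a ys" by (simp add: pairs132_idx_def)
      moreover have "ks = ?f (j', l')" using ks jl 0 by simp
      ultimately show ?thesis by blast
    next
      case (Suc i')
      with ks jl have "[i', j', l'] \<in> ?O ys" by (simp add: mem_occurrences_pattern_132)
      moreover have "ks = map Suc [i', j', l']" using ks jl Suc by simp
      ultimately show ?thesis by blast
    qed
  next
    fix ks assume "ks \<in> ?R"
    then show "ks \<in> ?L"
      by (auto simp: mem_occurrences_pattern_132 pairs132_idx_def)
  qed
  also have "card \<dots> = card (?f ` pairs132_idx a ys) + card (map Suc ` ?O ys)"
    by (intro card_Un_disjoint) (auto intro: finite_occurrences finite_pairs132_idx)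
  also have "\<dots> = card (pairs132_idx a ys) + card (?O ys)"
    by (intro arg_cong2[of _ _ _ _ "(+)"] card_image) (auto simp: inj_on_def)
  finally show ?case using Cons card_pairs132_idx by simp
qed

subsection \<open>Splitting at the maximum\<close>

text \<open>Entries not exceeding \<open>v\<close> can join no chain above \<open>v\<close>, and
  this persists when the lower bound rises along the chain.\<close>

lemma count_inc_append_le:
  "(\<And>y. y \<in> set ys \<Longrightarrow> y \<le> v) \<Longrightarrow> count_inc m v (xs @ ys) = count_inc m v xs"
proof (induction m v xs rule: count_inc.induct)
  case (2 m v)
  have "count_inc (Suc m) v ys = 0" using 2 by (induction ys) (force simp: not_less)+
  then show ?case by simp
next
  case (3 m v y zs)
  have "count_inc m y (zs @ ys) = count_inc m y zs" if "v < y"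
    using 3(1)[OF that] 3(3) that by (meson le_trans less_imp_le)
  with 3 show ?case by simp
qed auto

text \<open>A maximum at the end either stays out of the chain or is its last entry.\<close>

lemma count_inc_snoc_max:
  "v < n \<Longrightarrow> (\<And>x. x \<in> set xs \<Longrightarrow> x < n) \<Longrightarrow> count_inc (Suc m) v (xs @ [n]) = count_inc (Suc m) v xs + count_inc m v xs"
proof (induction xs arbitrary: m v)
  case Nil
  then show ?case by (cases m) auto
next
  case (Cons y ys)
  then show ?case by (cases m) auto
qed

lemma count_inc_antimono: "v \<le> w \<Longrightarrow> count_inc m w xs \<le> count_inc m v xs"
  by (induction m v xs arbitrary: w rule: count_inc.induct) (auto intro!: add_mono trans_le_add2)

text \<open>Deleting any one entry of a chain of length \<open>Suc m\<close> leaves a chain of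
  length \<open>m\<close>, and these \<open>Suc m\<close> chains are distinct.\<close>

lemma count_inc_Suc_pos: "count_inc (Suc m) v xs > 0 \<Longrightarrow> count_inc m v xs \<ge> Suc m"
proof (induction xs arbitrary: m v)
  case (Cons y ys)
  show ?case
  proof (cases m)
    case (Suc m')
    show ?thesis
    proof (cases "count_inc (Suc m) v ys > 0")
      case True
      then have "count_inc m v ys \<ge> Suc m" by (rule Cons.IH)
      then show ?thesis using Suc by simp
    next
      case False
      with Cons.prems have vy: "v < y" "count_inc m y ys > 0" by (auto split: if_splits)
      then have "count_inc m' y ys \<ge> Suc m'" using Cons.IH Suc by simp
      moreover have "count_inc m v ys \<ge> count_inc m y ys" using vy by (intro count_inc_antimono) simp
      ultimately show ?thesis using vy Suc by simp
    qed
  qed simp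
qed simp

text \<open>From an occurrence of the longer pattern any one of the \<open>Suc m\<close> letters
  above 2 can be deleted.\<close>

lemma count_21_Suc_pos: "count_21 (Suc m) xs > 0 \<Longrightarrow> count_21 m xs \<ge> Suc m"
proof (induction "Suc m" xs rule: count_21.induct)
  case (3 a b ys)
  then show ?case using count_inc_Suc_pos[of m a ys] by (auto split: if_splits)
qed auto

text \<open>A leading maximum could only be the letter 2, and nothing exceeds it; so it contributes
  only when the pattern is a mere descent.\<close>

lemma count_21_less: "(\<And>r. r \<in> set R \<Longrightarrow> r < n) \<Longrightarrow>
    count_21 m (n # R) = (if m = 0 \<and> R \<noteq> [] then 1 else 0) + count_21 m R"
proof (cases R)
  case (Cons b ys)
  assume "\<And>r. r \<in> set R \<Longrightarrow> r < n"
  then have "count_inc m n ys = count_inc m n []"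
    using count_inc_append_le[of ys n m "[]"] Cons by (simp add: less_imp_le)
  with Cons \<open>\<And>r. r \<in> set R \<Longrightarrow> r < n\<close> show ?thesis by (cases m) auto
qed simp

text \<open>An entry of \<open>L\<close> used as the letter 2 sees only smaller entries in
  \<open>R\<close>, so \<open>n\<close> can only end its occurrence. The separation from
  \<open>R\<close> is required for \<open>butlast L\<close>: the last entry of \<open>L\<close> is
  followed by an ascent and cannot be the letter 2. In this form the lemma also covers
  \<open>glue1\<close>.\<close>

lemma count_21_append_max:
  assumes "\<And>l. l \<in> set L \<Longrightarrow> l < n" "\<And>r. r \<in> set R \<Longrightarrow> r < n"
    and "\<And>l r. l \<in> set (butlast L) \<Longrightarrow> r \<in> set R \<Longrightarrow> r < l"
  shows "count_21 m (L @ n # R) =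
    count_21 m L + (case m of 0 \<Rightarrow> (if R = [] then 0 else 1) | Suc m' \<Rightarrow> count_21 m' L) + count_21 m R"
  using assms
proof (induction L rule: induct_list012)
  case 1
  then show ?case using count_21_less[of R n m] by (simp split: nat.split)
next
  case (2 a)
  then show ?case using count_21_less[of R n m] by (simp split: nat.split)
next
  case (3 a b ys)
  have "count_inc m a ((ys @ [n]) @ R) = count_inc m a (ys @ [n])"
    using 3(5)[of a] by (intro count_inc_append_le) (auto simp: less_imp_le)
  moreover have "count_inc (Suc m') a (ys @ [n]) = count_inc (Suc m') a ys + count_inc m' a ys" for m'
    using 3(3) by (intro count_inc_snoc_max) auto
  moreover have "count_21 m (b # ys @ n # R) =
    count_21 m (b # ys) + (case m of 0 \<Rightarrow> (if R = [] then 0 else 1) | Suc m' \<Rightarrow> count_21 m' (b # ys)) + count_21 m R"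
    using 3(2)[OF 3(3,4,5)] by auto
  ultimately show ?case by (simp split: nat.split)
qed

text \<open>A final minimum can only be the letter 1, and then no place is left for a letter
  3.\<close>

lemma count_21_snoc_min:
  "(\<And>x. x \<in> set L \<Longrightarrow> l < x) \<Longrightarrow> count_21 m (L @ [l]) = count_21 m L + (if m = 0 \<and> L \<noteq> [] then 1 else 0)"
proof (induction L rule: induct_list012)
  case (2 a)
  then show ?case by (cases m) auto
next
  case (3 a b ys)
  then have "count_inc m a (ys @ [l]) = count_inc m a ys"
    by (intro count_inc_append_le) (auto simp: less_imp_le)
  with 3 show ?case by simp
qed simp

text \<open>This and the next three lemmas express invariance under order-preserving relabelling, by
  which the two sides of a maximum can be standardised.\<close>

lemma count_inc_map:
  "strict_mono_on (insert v (set xs)) f \<Longrightarrow> count_inc m (f v) (map f xs) = count_inc m v xs"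
proof (induction m v xs rule: count_inc.induct)
  case (3 m v y ys)
  have "strict_mono_on (insert y (set ys)) f" "strict_mono_on (insert v (set ys)) f"
    using 3(3) by (auto elim: monotone_on_subset)
  moreover have "f v < f y \<longleftrightarrow> v < y"
    using strict_mono_on_less[OF 3(3)] by simp
  ultimately show ?case using 3 by simp
qed auto

lemma count_21_map: "strict_mono_on (set xs) f \<Longrightarrow> count_21 m (map f xs) = count_21 m xs"
proof (induction xs rule: induct_list012)
  case (3 a b ys)
  have "strict_mono_on (insert a (set ys)) f" "strict_mono_on (set (b # ys)) f"
    using 3(3) by (auto elim: monotone_on_subset)
  moreover have "f b < f a \<longleftrightarrow> b < a"
    using strict_mono_on_less[OF 3(3)] by simp
  ultimately show ?case using 3 count_inc_map by simp
qed auto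

lemma pairs132_map:
  "strict_mono_on (insert a (set xs)) f \<Longrightarrow> pairs132 (f a) (map f xs) = pairs132 a xs"
proof (induction xs)
  case (Cons y ys)
  have "strict_mono_on (insert a (set ys)) f"
    using Cons(2) by (auto elim: monotone_on_subset)
  moreover have "filter ((\<lambda>z. f a < z \<and> z < f y) \<circ> f) ys = filter (\<lambda>z. a < z \<and> z < y) ys"
    using strict_mono_on_less[OF Cons(2)] by (intro filter_cong) auto
  ultimately show ?case using Cons(1) by (simp add: filter_map)
qed simp

lemma count_132_map: "strict_mono_on (set xs) f \<Longrightarrow> count_132 (map f xs) = count_132 xs"
proof (induction xs)
  case (Cons y ys)
  have "strict_mono_on (set ys) f"
    using Cons(2) by (auto elim: monotone_on_subset)
  with Cons pairs132_map show ?case by simp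
qed simp

text \<open>For entries below \<open>n\<close>, \<open>cross132 L R\<close> counts the occurrences of 132 in \<open>L @ n # R\<close> that are
  neither inside \<open>L\<close> nor inside \<open>R\<close>.\<close>

fun cross132 :: "nat list \<Rightarrow> nat list \<Rightarrow> nat" where
  "cross132 [] R = 0"
| "cross132 (a # L) R = (\<Sum>b\<leftarrow>L. length (filter (\<lambda>r. a < r \<and> r < b) R)) +
     length (filter ((<) a) R) + pairs132 a R + cross132 L R"

section \<open>Occurrences of 132 across the maximum\<close>

lemma pairs132_append:
  "pairs132 a (L @ R) = pairs132 a L + (\<Sum>b\<leftarrow>L. length (filter (\<lambda>r. a < r \<and> r < b) R)) + pairs132 a R"
  by (induction L) auto

lemma pairs132_ge: "(\<And>r. r \<in> set R \<Longrightarrow> r \<le> a) \<Longrightarrow> pairs132 a R = 0"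
  by (induction R) (auto simp: filter_empty_conv not_less)

lemma pairs132_at_most_one: "length (filter ((<) a) R) \<le> 1 \<Longrightarrow> pairs132 a R = 0"
  by (induction R) (auto simp: filter_empty_conv split: if_splits)

text \<open>The maximum can only be the letter 3, with its 1 in \<open>L\<close> and its 2 in
  \<open>R\<close>; these occurrences are the second summand of \<open>cross132\<close>.\<close>

lemma count_132_append_max:
  assumes "\<And>l. l \<in> set L \<Longrightarrow> l < n" "\<And>r. r \<in> set R \<Longrightarrow> r < n"
  shows "count_132 (L @ n # R) = count_132 L + count_132 R + cross132 L R"
  using assms
proof (induction L)
  case Nil
  then show ?case using pairs132_ge[of R n] by (simp add: less_imp_le)
next
  case (Cons a L)
  have "filter (\<lambda>r. a < r \<and> r < n) R = filter ((<) a) R"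
    using Cons(3) by (intro filter_cong) auto
  moreover have "(\<Sum>b\<leftarrow>L. length (filter (\<lambda>r. a < r \<and> r < b) (n # R))) =
      (\<Sum>b\<leftarrow>L. length (filter (\<lambda>r. a < r \<and> r < b) R))"
    using Cons(2) by (intro arg_cong[of _ _ sum_list] map_cong) (auto dest: less_asym)
  ultimately show ?case using Cons by (simp add: pairs132_append del: filter.simps)
qed

lemma count_132_snoc_min: "(\<And>x. x \<in> set L \<Longrightarrow> l \<le> x) \<Longrightarrow> count_132 (L @ [l]) = count_132 L"
proof (induction L)
  case (Cons a L)
  then have "\<not> a < l" by (simp add: not_less)
  with Cons show ?case by (simp add: pairs132_append)
qed simp

text \<open>Any \<open>l\<close> in \<open>L\<close> and larger \<open>r\<close> in \<open>R\<close>
  form a 132 with the maximum between them.\<close>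

lemma cross132_eq_0_iff: "cross132 L R = 0 \<longleftrightarrow> (\<forall>l\<in>set L. \<forall>r\<in>set R. r \<le> l)"
proof (induction L)
  case (Cons a L)
  show ?case
  proof
    assume "cross132 (a # L) R = 0"
    with Cons show "\<forall>l\<in>set (a # L). \<forall>r\<in>set R. r \<le> l"
      by (auto simp: filter_empty_conv not_less)
  next
    assume *: "\<forall>l\<in>set (a # L). \<forall>r\<in>set R. r \<le> l"
    then have "filter (\<lambda>r. a < r \<and> r < b) R = []" "filter ((<) a) R = []" for b
      by (auto simp: filter_empty_conv not_less)
    with * Cons pairs132_ge[of R a] show "cross132 (a # L) R = 0" by simp
  qed
qed simp

text \<open>The single occurrence consists of some \<open>l\<close>, the maximum and some
  \<open>r > l\<close>. An entry \<open>b\<close> of \<open>L\<close> after \<open>l\<close> would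
  give another one: \<open>b\<close>, the maximum, \<open>r\<close> if \<open>b < r\<close>, and
  \<open>l\<close>, \<open>b\<close>, \<open>r\<close> if \<open>b > r\<close>. Hence
  \<open>l\<close> is last.\<close>

lemma cross132_eq_1D:
  assumes "cross132 L R = 1" "set L \<inter> set R = {}"
  shows "\<exists>L' l. L = L' @ [l] \<and> (\<forall>a\<in>set L'. \<forall>r\<in>set R. r < a) \<and> length (filter ((<) l) R) = 1"
  using assms
proof (induction L)
  case (Cons a L)
  show ?case
  proof (cases "\<exists>r\<in>set R. a < r")
    case True
    then obtain r where r: "r \<in> set R" "a < r" by blast
    then have "length (filter ((<) a) R) > 0" by (auto simp: filter_empty_conv)
    with Cons.prems have len: "length (filter ((<) a) R) = 1" "cross132 L R = 0"
      and sum: "(\<Sum>b\<leftarrow>L. length (filter (\<lambda>r. a < r \<and> r < b) R)) = 0"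
      by (unfold cross132.simps) linarith+
    have "L = []"
    proof (rule ccontr)
      assume "L \<noteq> []"
      then obtain b where b: "b \<in> set L" by (cases L) auto
      with len r have "r \<le> b" by (simp add: cross132_eq_0_iff)
      with b r Cons.prems have "r < b" by (metis disjoint_iff le_neq_implies_less list.set_intros(2))
      with sum b r show False by (auto simp: filter_empty_conv)
    qed
    with len show ?thesis by simp
  next
    case False
    then have a: "\<forall>r\<in>set R. r \<le> a" by (simp add: not_less)
    then have "filter (\<lambda>r. a < r \<and> r < b) R = []" "filter ((<) a) R = []" for b
      by (auto simp: filter_empty_conv not_less)
    with Cons.prems pairs132_ge[of R a] a have "cross132 L R = 1" by simp
    with Cons obtain L' l where L: "L = L' @ [l]" "\<forall>a\<in>set L'. \<forall>r\<in>set R. r < a"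
      "length (filter ((<) l) R) = 1" by auto
    have "\<forall>r\<in>set R. r < a" using a Cons.prems(2) by (auto simp: le_less)
    with L show ?thesis by (intro exI[of _ "a # L'"] exI[of _ l]) auto
  qed
qed simp

lemma cross132_eq_1I:
  assumes "\<forall>a\<in>set L'. \<forall>r\<in>set R. r < a" "length (filter ((<) l) R) = 1"
  shows "cross132 (L' @ [l]) R = 1"
  using assms
proof (induction L')
  case Nil
  then show ?case using pairs132_at_most_one[of l R] by simp
next
  case (Cons a L')
  then have "filter (\<lambda>r. a < r \<and> r < b) R = []" "filter ((<) a) R = []" for b
    by (auto simp: filter_empty_conv not_less less_imp_le)
  with Cons pairs132_ge[of R a] show ?case by (simp add: less_imp_le)
qed

subsection \<open>Decomposition of permutations with at most one 132\<close>

definition perms :: "nat list set" where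
  "perms = {\<pi>. distinct \<pi> \<and> set \<pi> = {1..length \<pi>}}"

definition glue :: "nat list \<Rightarrow> nat list \<Rightarrow> nat list" where
  "glue L R = map (\<lambda>x. x + length R) L @ (length L + length R + 1) # R"

text \<open>Meant for arguments in \<open>{1..s}\<close>, where it is the increasing bijection onto
  \<open>{1..s + 1}\<close> without \<open>s\<close>. It frees the value \<open>s\<close> for the
  letter before the maximum.\<close>

definition skip_val :: "nat \<Rightarrow> nat \<Rightarrow> nat" where
  "skip_val s y = (if y = s then Suc y else y)"

text \<open>The remaining permutations with a single 132: its letters are the values \<open>length R\<close>, the maximum,
  and \<open>length R + 1\<close>, where \<open>length R\<close> immediately precedes the maximum.\<close>

definition glue1 :: "nat list \<Rightarrow> nat list \<Rightarrow> nat list" where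
  "glue1 L R = (map (\<lambda>x. x + length R + 1) L @ [length R]) @ (length L + length R + 2) #
     map (skip_val (length R)) R"

lemma permsD:
  assumes "\<pi> \<in> perms"
  shows "distinct \<pi>" "x \<in> set \<pi> \<longleftrightarrow> 1 \<le> x \<and> x \<le> length \<pi>"
  using assms by (auto simp: perms_def)

lemma length_glue: "length (glue L R) = length L + length R + 1"
  by (simp add: glue_def)

lemma length_glue1: "length (glue1 L R) = length L + length R + 2"
  by (simp add: glue1_def)

lemma Nil_in_perms: "[] \<in> perms"
  by (simp add: perms_def)

lemma distinct_set_imp_perms: "distinct xs \<Longrightarrow> set xs = {1..n} \<Longrightarrow> xs \<in> perms"
  using distinct_card[of xs] by (simp add: perms_def)

lemma glue_in_perms:
  assumes "L \<in> perms" "R \<in> perms"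
  shows "glue L R \<in> perms"
proof (rule distinct_set_imp_perms)
  note L = permsD[OF assms(1)] and R = permsD[OF assms(2)]
  show "distinct (glue L R)"
    using L R by (auto simp: glue_def distinct_map inj_on_def)
  have "x \<in> (\<lambda>x. x + length R) ` set L" if "length R < x" "x \<le> length L + length R" for x
    using that L(2)[of "x - length R"] by (intro rev_image_eqI[of "x - length R"]) auto
  then show "set (glue L R) = {1..length L + length R + 1}"
    using L R by (auto simp: glue_def not_le)
qed

lemma skip_val_strict_mono: "strict_mono_on {1..s} (skip_val s)"
  by (auto simp: strict_mono_on_def skip_val_def)

lemma glue1_in_perms:
  assumes "L \<in> perms" "R \<in> perms" "R \<noteq> []"
  shows "glue1 L R \<in> perms"
proof (rule distinct_set_imp_perms)
  note L = permsD[OF assms(1)] and R = permsD[OF assms(2)]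
  let ?r = "length R"
  have r: "?r \<ge> 1" using assms(3) by (cases R) auto
  have setR: "set R = {1..?r}" using assms(2) by (simp add: perms_def)
  have "inj_on (skip_val ?r) (set R)"
    unfolding setR by (rule strict_mono_on_imp_inj_on[OF skip_val_strict_mono])
  then have "distinct (map (skip_val ?r) R)" using R(1) by (simp add: distinct_map)
  moreover have "distinct (map (\<lambda>x. x + ?r + 1) L)" using L(1) by (simp add: distinct_map inj_on_def)
  moreover have "skip_val ?r x \<noteq> ?r" "skip_val ?r x \<le> ?r + 1" if "x \<in> set R" for x
    using that R(2)[of x] by (auto simp: skip_val_def)
  moreover have "x + ?r + 1 > ?r + 1" "x \<le> length L" if "x \<in> set L" for x
    using that L(2)[of x] by auto
  ultimately show "distinct (glue1 L R)"
    unfolding glue1_def distinct_append distinct.simps set_append set_map list.set by fastforce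
  have "x \<in> (\<lambda>x. x + ?r + 1) ` set L" if "?r + 1 < x" "x \<le> length L + ?r + 1" for x
    using that L(2)[of "x - ?r - 1"] by (intro rev_image_eqI[of "x - ?r - 1"]) auto
  moreover have "skip_val ?r ` set R = {1..?r + 1} - {?r}"
  proof (intro equalityI subsetI)
    fix x assume "x \<in> {1..?r + 1} - {?r}"
    then show "x \<in> skip_val ?r ` set R"
      unfolding setR using r
      by (intro rev_image_eqI[of "if x = ?r + 1 then ?r else x"]) (auto simp: skip_val_def)
  qed (auto simp: setR skip_val_def)
  moreover have "set L = {1..length L}" using assms(1) by (simp add: perms_def)
  ultimately show "set (glue1 L R) = {1..length L + ?r + 2}"
    using r unfolding glue1_def set_append set_map list.set
    by (intro equalityI subsetI; force)
qed

lemma split_at_max_unique: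
  fixes n :: nat
  assumes "A @ n # B = A' @ n # B'" "\<And>x. x \<in> set A \<Longrightarrow> x < n" "\<And>x. x \<in> set B \<Longrightarrow> x < n"
  shows "A = A' \<and> B = B'"
  using assms append_Cons_eq_iff[of n A B A' B'] by blast

lemma glue_parts:
  assumes "L \<in> perms" "R \<in> perms" "x \<in> set (map (\<lambda>x. x + length R) L)"
  shows "length R < x" "x < length L + length R + 1"
  using assms permsD(2)[OF assms(1)] by auto

lemma inj_on_glue: "inj_on (\<lambda>(L, R). glue L R) (perms \<times> perms)"
proof -
  have "L = L' \<and> R = R'"
    if "L \<in> perms" "R \<in> perms" "L' \<in> perms" "R' \<in> perms" "glue L R = glue L' R'" for L R L' R'
  proof -
    have n: "length L + length R + 1 = length L' + length R' + 1"
      using that(5) by (metis length_glue)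
    have "map (\<lambda>x. x + length R) L = map (\<lambda>x. x + length R') L' \<and> R = R'"
      using that(5) glue_parts(2)[OF that(1,2)] permsD(2)[OF that(2)]
      unfolding glue_def n[symmetric] by (intro split_at_max_unique) auto
    then show ?thesis by (auto dest: map_injective[rotated] simp: inj_on_def)
  qed
  then show ?thesis by (auto simp: inj_on_def)
qed

lemma glue1_parts:
  assumes "L \<in> perms" "R \<in> perms"
  shows "x \<in> set (map (\<lambda>x. x + length R + 1) L @ [length R]) \<Longrightarrow> x < length L + length R + 2"
    "x \<in> set (map (\<lambda>x. x + length R + 1) L) \<Longrightarrow> x > length R + 1"
    "x \<in> set (map (skip_val (length R)) R) \<Longrightarrow> x \<le> length R + 1"
  using permsD(2)[OF assms(1)] permsD(2)[OF assms(2)] by (auto simp: skip_val_def)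

text \<open>The letter just before the maximum reveals \<open>length R\<close>, after which both
  relabellings can be inverted.\<close>

lemma inj_on_glue1: "inj_on (\<lambda>(L, R). glue1 L R) (perms \<times> perms)"
proof -
  have "L = L' \<and> R = R'"
    if "L \<in> perms" "R \<in> perms" "L' \<in> perms" "R' \<in> perms" "glue1 L R = glue1 L' R'" for L R L' R'
  proof -
    have n: "length L + length R + 2 = length L' + length R' + 2"
      using that(5) by (metis length_glue1)
    have *: "map (\<lambda>x. x + length R + 1) L @ [length R] = map (\<lambda>x. x + length R' + 1) L' @ [length R'] \<and>
       map (skip_val (length R)) R = map (skip_val (length R')) R'"
    proof (rule split_at_max_unique)
      show "(map (\<lambda>x. x + length R + 1) L @ [length R]) @ (length L + length R + 2) # map (skip_val (length R)) R =
        (map (\<lambda>x. x + length R' + 1) L' @ [length R']) @ (length L + length R + 2) # map (skip_val (length R')) R'"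
        using that(5) unfolding glue1_def n[symmetric] .
    next
      fix x assume "x \<in> set (map (skip_val (length R)) R)"
      then show "x < length L + length R + 2" using glue1_parts(3)[OF that(1,2)] by fastforce
    qed (rule glue1_parts(1)[OF that(1,2)])
    then have "length R = length R'" by simp
    moreover from this * have "L = L'" by (auto dest: map_injective[rotated] simp: inj_on_def)
    moreover have "R = R'"
    proof (rule map_inj_on)
      show "map (skip_val (length R)) R = map (skip_val (length R)) R'" using * \<open>length R = length R'\<close> by simp
      have "set R = {1..length R}" "set R' = {1..length R}"
        using that \<open>length R = length R'\<close> by (simp_all add: perms_def)
      then show "inj_on (skip_val (length R)) (set R \<union> set R')"
        using strict_mono_on_imp_inj_on[OF skip_val_strict_mono] by simp
    qed
    ultimately show ?thesis by simp
  qed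
  then show ?thesis by (auto simp: inj_on_def)
qed

text \<open>Equality would force \<open>length R = length R'\<close>; but every letter before the
  maximum of \<open>glue L R\<close> exceeds \<open>length R\<close>, while
  \<open>glue1 L' R'\<close> has the letter \<open>length R'\<close> there.\<close>

lemma glue_neq_glue1:
  assumes "L \<in> perms" "R \<in> perms" "L' \<in> perms" "R' \<in> perms"
  shows "glue L R \<noteq> glue1 L' R'"
proof
  assume eq: "glue L R = glue1 L' R'"
  then have n: "length L' + length R' + 2 = length L + length R + 1"
    by (metis length_glue length_glue1)
  have *: "map (\<lambda>x. x + length R) L = map (\<lambda>x. x + length R' + 1) L' @ [length R'] \<and>
     R = map (skip_val (length R')) R'"
    using eq glue_parts(2)[OF assms(1,2)] permsD(2)[OF assms(2)]
    unfolding glue_def glue1_def n by (intro split_at_max_unique) auto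
  then have "length R = length R'" by (metis length_map)
  moreover have "length R' \<in> set (map (\<lambda>x. x + length R) L)"
    unfolding conjunct1[OF *] by simp
  ultimately show False using glue_parts(1)[OF assms(1,2)] by force
qed

text \<open>Identifies the values to the right of the maximum, possibly together with the letter
  before it, as an initial segment.\<close>

lemma down_closed_eq:
  fixes A :: "nat set"
  assumes "finite A" "0 \<notin> A" "\<And>a x. a \<in> A \<Longrightarrow> 1 \<le> x \<Longrightarrow> x \<le> a \<Longrightarrow> x \<in> A"
  shows "A = {1..card A}"
proof (cases "A = {}")
  case False
  have "A = {1..Max A}"
  proof (intro equalityI subsetI)
    fix x assume "x \<in> A"
    with assms(1,2) show "x \<in> {1..Max A}" by (cases x) auto
  next
    fix x assume "x \<in> {1..Max A}"
    with assms(3)[of "Max A" x] assms(1) False show "x \<in> A" by simp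
  qed
  then show ?thesis by (metis card_atLeastAtMost diff_Suc_1)
qed simp

lemma map_diff_in_perms:
  assumes "distinct xs" "\<And>x. x \<in> set xs \<longleftrightarrow> c < x \<and> x < c + length xs + 1"
  shows "map (\<lambda>x. x - c) xs \<in> perms"
proof (rule distinct_set_imp_perms)
  have set: "set xs = {c<..<c + length xs + 1}"
    using assms(2) by (intro equalityI subsetI) simp_all
  show "distinct (map (\<lambda>x. x - c) xs)"
    using assms(1) by (auto simp: distinct_map inj_on_def set)
  have "x \<in> (\<lambda>x. x - c) ` set xs" if "1 \<le> x" "x \<le> length xs" for x
    using that by (intro rev_image_eqI[of "x + c"]) (simp_all add: set)
  moreover have "x - c \<in> {1..length xs}" if "x \<in> set xs" for x
    using that by (auto simp: set)
  ultimately show "set (map (\<lambda>x. x - c) xs) = {1..length xs}" unfolding set_map by fastforce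
qed

lemma perms_cases:
  assumes "\<pi> \<in> perms" "\<pi> \<noteq> []" "count_132 \<pi> \<le> 1"
  shows "(\<exists>L\<in>perms. \<exists>R\<in>perms. \<pi> = glue L R) \<or> (\<exists>L\<in>perms. \<exists>R\<in>perms - {[]}. \<pi> = glue1 L R)"
proof -
  define n where "n = length \<pi>"
  have "n \<ge> 1" using assms(2) by (cases \<pi>) (auto simp: n_def)
  then have "n \<in> set \<pi>" using permsD(2)[OF assms(1)] by (simp add: n_def)
  then obtain L R where \<pi>: "\<pi> = L @ n # R" by (auto dest: split_list)
  have d: "distinct L" "distinct R" "set L \<inter> set R = {}" "n \<notin> set L" "n \<notin> set R"
    using permsD(1)[OF assms(1)] \<pi> by auto
  have len: "n = length L + length R + 1" using arg_cong[OF \<pi>, of length] by (simp add: n_def)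
  have LR: "x \<in> set L \<or> x \<in> set R \<longleftrightarrow> 1 \<le> x \<and> x < n" for x
    using permsD(2)[OF assms(1), of x, folded n_def] d(4,5) le_less[of x n] unfolding \<pi> by auto
  have "count_132 \<pi> = count_132 L + count_132 R + cross132 L R"
    unfolding \<pi> using LR by (intro count_132_append_max) auto
  with assms(3) consider "cross132 L R = 0" | "cross132 L R = 1" by linarith
  then show ?thesis
  proof cases
    case 1
    then have less: "r < l" if "l \<in> set L" "r \<in> set R" for l r
      using that d(3) by (auto simp: cross132_eq_0_iff le_less)
    have setR: "set R = {1..length R}"
      unfolding distinct_card[OF d(2), symmetric]
    proof (rule down_closed_eq)
      show "0 \<notin> set R" using LR[of 0] by simp
      fix a x assume "a \<in> set R" "1 \<le> x" "x \<le> a"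
      then show "x \<in> set R" using LR[of x] LR[of a] less[of x a] by auto
    qed simp
    then have setL: "x \<in> set L \<longleftrightarrow> length R < x \<and> x < n" for x
      using LR[of x] d(3) by auto
    define L0 where "L0 = map (\<lambda>x. x - length R) L"
    have "L = map (\<lambda>x. x + length R) L0"
      unfolding L0_def map_map by (rule map_idI[symmetric]) (simp add: setL)
    have "L0 \<in> perms"
      unfolding L0_def using d(1) len by (intro map_diff_in_perms) (auto simp: setL)
    moreover have "R \<in> perms" using setR d(2) by (rule distinct_set_imp_perms[rotated])
    moreover have "\<pi> = glue L0 R"
      using \<open>L = map (\<lambda>x. x + length R) L0\<close> \<pi> len by (simp add: glue_def L0_def)
    ultimately show ?thesis by blast
  next
    case 2
    from cross132_eq_1D[OF this d(3)] obtain L' l where L: "L = L' @ [l]"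
      "\<And>a r. a \<in> set L' \<Longrightarrow> r \<in> set R \<Longrightarrow> r < a" "length (filter ((<) l) R) = 1" by blast
    define s where "s = length R"
    have l: "l \<notin> set R" "l \<notin> set L'" using d L(1) by auto
    obtain r0 where r0: "r0 \<in> set R" "l < r0"
      using L(3) by (cases "filter ((<) l) R = []") (auto simp: filter_empty_conv)
    \<comment> \<open>No letter of \<open>L'\<close> can lie below an element of this set:
      \<open>L'\<close> is above \<open>R\<close>, and above \<open>l\<close> because
      \<open>l < r0\<close>.\<close>
    have A: "insert l (set R) = {1..Suc s}"
    proof -
      have "insert l (set R) = {1..card (insert l (set R))}"
      proof (rule down_closed_eq)
        show "0 \<notin> insert l (set R)" using LR[of 0] L(1) by auto
        fix a x assume a: "a \<in> insert l (set R)" "1 \<le> x" "x \<le> a"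
        show "x \<in> insert l (set R)"
        proof (rule ccontr)
          assume x: "x \<notin> insert l (set R)"
          have "x < n" using LR[of a] a L(1) by auto
          with LR[of x] a x L(1) have "x \<in> set L'" by auto
          with L(2)[of x a] L(2)[of x r0] a r0 show False by auto
        qed
      qed simp
      then show ?thesis using l distinct_card[OF d(2)] by (simp add: s_def)
    qed
    \<comment> \<open>Exactly one letter of \<open>R\<close> exceeds \<open>l\<close>, and these
      letters are the values from \<open>l + 1\<close> to \<open>s + 1\<close>; so
      \<open>l = s\<close>.\<close>
    have "card {z \<in> set R. l < z} = 1"
      using L(3) distinct_card[of "filter ((<) l) R"] d(2) by simp
    moreover have "{z \<in> set R. l < z} = {Suc l..Suc s}"
    proof (intro equalityI subsetI)
      fix z assume "z \<in> {Suc l..Suc s}"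
      moreover from this have "z \<in> insert l (set R)" unfolding A by auto
      ultimately show "z \<in> {z \<in> set R. l < z}" by auto
    next
      fix z assume z: "z \<in> {z \<in> set R. l < z}"
      then have "z \<in> {1..Suc s}" unfolding A[symmetric] by auto
      with z show "z \<in> {Suc l..Suc s}" by auto
    qed
    ultimately have ls: "l = s" by simp
    have setR: "set R = {1..Suc s} - {s}"
      unfolding A[symmetric] using l(1) ls by simp
    have "s \<ge> 1" using r0(1) by (cases R) (auto simp: s_def)
    have setL: "x \<in> set L' \<longleftrightarrow> s + 1 < x \<and> x < n" for x
    proof -
      have "x \<in> set L' \<or> x \<in> {1..Suc s} \<longleftrightarrow> 1 \<le> x \<and> x < n"
        unfolding A[symmetric] using LR[of x] L(1) by auto
      moreover have "\<not> (x \<in> set L' \<and> x \<in> {1..Suc s})"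
        unfolding A[symmetric] using d(3) l(2) L(1) by auto
      ultimately show ?thesis by auto
    qed
    \<comment> \<open>\<open>L0\<close> undoes the upward shift and \<open>R0\<close> undoes
      \<open>skip_val s\<close>; in \<open>R\<close> only the value \<open>s + 1\<close> has to
      move.\<close>
    define L0 where "L0 = map (\<lambda>x. x - (s + 1)) L'"
    define R0 where "R0 = map (\<lambda>y. if y = Suc s then s else y) R"
    have L0: "L0 \<in> perms"
      unfolding L0_def using d(1) len L(1) by (intro map_diff_in_perms) (auto simp: setL s_def)
    have R0: "R0 \<in> perms"
    proof (rule distinct_set_imp_perms)
      show "distinct R0" using d(2) by (auto simp: R0_def distinct_map inj_on_def setR)
      have "x \<in> (\<lambda>y. if y = Suc s then s else y) ` set R" if "1 \<le> x" "x \<le> s" for x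
        using that by (intro rev_image_eqI[of "if x = s then Suc s else x"]) (auto simp: setR)
      then show "set R0 = {1..s}"
        using \<open>s \<ge> 1\<close> unfolding R0_def set_map by (auto simp: setR)
    qed
    have "R = map (skip_val s) R0"
      unfolding R0_def map_map
      by (rule map_idI[symmetric]) (auto simp: skip_val_def setR)
    moreover have "L' = map (\<lambda>x. x + s + 1) L0"
      unfolding L0_def map_map by (rule map_idI[symmetric]) (auto simp: setL)
    moreover have "length R0 = s" "length L0 + length R0 + 2 = n"
      using len L(1) by (simp_all add: R0_def s_def L0_def)
    ultimately have "\<pi> = glue1 L0 R0"
      using \<pi> L(1) ls by (simp add: glue1_def)
    moreover have "R0 \<noteq> []" using \<open>s \<ge> 1\<close> \<open>length R0 = s\<close> by auto
    ultimately show ?thesis using L0 R0 by blast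
  qed
qed

section \<open>Both statistics on glued permutations\<close>

lemma count_132_glue:
  assumes "L \<in> perms" "R \<in> perms"
  shows "count_132 (glue L R) = count_132 L + count_132 R"
proof -
  note parts = glue_parts[OF assms] permsD(2)[OF assms(2)]
  have "count_132 (glue L R) = count_132 (map (\<lambda>x. x + length R) L) + count_132 R + cross132 (map (\<lambda>x. x + length R) L) R"
    unfolding glue_def using parts by (intro count_132_append_max) auto
  moreover have "cross132 (map (\<lambda>x. x + length R) L) R = 0"
    unfolding cross132_eq_0_iff using parts by fastforce
  moreover have "count_132 (map (\<lambda>x. x + length R) L) = count_132 L"
    by (rule count_132_map) (simp add: strict_mono_on_def)
  ultimately show ?thesis by simp
qed

lemma count_21_glue:
  assumes "L \<in> perms" "R \<in> perms"
  shows "count_21 m (glue L R) =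
    count_21 m L + (case m of 0 \<Rightarrow> (if R = [] then 0 else 1) | Suc m' \<Rightarrow> count_21 m' L) + count_21 m R"
proof -
  note parts = glue_parts[OF assms] permsD(2)[OF assms(2)]
  have "count_21 m (map (\<lambda>x. x + length R) L) = count_21 m L" for m
    by (rule count_21_map) (simp add: strict_mono_on_def)
  moreover have "r < l" if "l \<in> set (butlast (map (\<lambda>x. x + length R) L))" "r \<in> set R" for l r
    using parts(1)[OF in_set_butlastD[OF that(1)]] parts(3)[of r] that(2) by simp
  ultimately show ?thesis
    unfolding glue_def using parts
    by (subst count_21_append_max) (auto split: nat.split)
qed

lemma count_132_glue1:
  assumes "L \<in> perms" "R \<in> perms" "R \<noteq> []"
  shows "count_132 (glue1 L R) = count_132 L + count_132 R + 1"
proof -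
  note parts = glue1_parts[OF assms(1,2)]
  let ?r = "length R"
  let ?L = "map (\<lambda>x. x + ?r + 1) L" and ?R = "map (skip_val ?r) R"
  have setR: "set R = {1..?r}" using assms(2) by (simp add: perms_def)
  have r: "?r \<ge> 1" using assms(3) by (cases R) auto
  have "count_132 (glue1 L R) = count_132 (?L @ [?r]) + count_132 ?R + cross132 (?L @ [?r]) ?R"
    unfolding glue1_def using parts by (intro count_132_append_max) fastforce+
  moreover have "cross132 (?L @ [?r]) ?R = 1"
  proof (rule cross132_eq_1I)
    show "\<forall>a\<in>set ?L. \<forall>r\<in>set ?R. r < a" using parts(2,3) by fastforce
    \<comment> \<open>Only the letter \<open>?r\<close>, which is relabelled to
      \<open>?r + 1\<close>, ends up above \<open>?r\<close>.\<close>
    have "filter ((<) ?r \<circ> skip_val ?r) R = filter (\<lambda>y. y = ?r) R"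
      using permsD(2)[OF assms(2)] by (intro filter_cong) (auto simp: skip_val_def)
    moreover have "length (filter (\<lambda>y. y = ?r) R) = 1"
    proof -
      have "?r \<in> set R" using setR r by simp
      then have "{y \<in> set R. y = ?r} = {?r}" by blast
      then show ?thesis
        using distinct_card[of "filter (\<lambda>y. y = ?r) R"] permsD(1)[OF assms(2)] by simp
    qed
    ultimately show "length (filter ((<) ?r) ?R) = 1" by (simp add: filter_map)
  qed
  moreover have "count_132 (?L @ [?r]) = count_132 ?L"
    using parts(2) by (intro count_132_snoc_min) fastforce
  moreover have "count_132 ?L = count_132 L"
    by (rule count_132_map) (simp add: strict_mono_on_def)
  moreover have "count_132 ?R = count_132 R"
    by (rule count_132_map) (simp only: setR skip_val_strict_mono)
  ultimately show ?thesis by simp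
qed

text \<open>The last letter of a nonempty \<open>L\<close> forms a descent with the letter
  \<open>length R\<close>. It counts for \<open>m = 0\<close>, and for \<open>m = 1\<close> with the
  maximum as letter 3. The maximum itself starts one further descent.\<close>

lemma count_21_glue1:
  assumes "L \<in> perms" "R \<in> perms" "R \<noteq> []"
  shows "count_21 m (glue1 L R) =
    count_21 m L + count_21 m R +
    (case m of 0 \<Rightarrow> 1 + (if L = [] then 0 else 1)
     | Suc m' \<Rightarrow> count_21 m' L + (if m' = 0 \<and> L \<noteq> [] then 1 else 0))"
proof -
  note parts = glue1_parts[OF assms(1,2)]
  let ?r = "length R"
  let ?L = "map (\<lambda>x. x + ?r + 1) L" and ?R = "map (skip_val ?r) R"
  have setR: "set R = {1..?r}" using assms(2) by (simp add: perms_def)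
  have "count_21 m (glue1 L R) = count_21 m (?L @ [?r]) +
      (case m of 0 \<Rightarrow> (if ?R = [] then 0 else 1) | Suc m' \<Rightarrow> count_21 m' (?L @ [?r])) + count_21 m ?R"
    unfolding glue1_def
  proof (rule count_21_append_max)
    fix l r assume "l \<in> set (butlast (?L @ [?r]))" "r \<in> set ?R"
    then show "r < l" using parts(2)[of l] parts(3)[of r] by (simp add: butlast_append)
  next
    fix l assume "l \<in> set (?L @ [?r])"
    then show "l < length L + ?r + 2" by (rule parts(1))
  next
    fix r assume "r \<in> set ?R"
    then show "r < length L + ?r + 2" using parts(3)[of r] by simp
  qed
  moreover have "count_21 m (?L @ [?r]) = count_21 m ?L + (if m = 0 \<and> ?L \<noteq> [] then 1 else 0)" for m
    using parts(2) by (intro count_21_snoc_min) fastforce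
  moreover have "count_21 m ?L = count_21 m L" for m
    by (rule count_21_map) (simp add: strict_mono_on_def)
  moreover have "count_21 m ?R = count_21 m R"
    by (rule count_21_map) (simp only: setR skip_val_strict_mono)
  ultimately show ?thesis using assms(3) by (simp split: nat.split)
qed

subsection \<open>Generating functions\<close>

definition gf :: "nat list set \<Rightarrow> real fps" where
  "gf S = Abs_fps (\<lambda>n. of_nat (card {\<pi> \<in> S. length \<pi> = n}))"

definition gf2 :: "(nat list \<times> nat list) set \<Rightarrow> real fps" where
  "gf2 T = Abs_fps (\<lambda>n. of_nat (card {p \<in> T. length (fst p) + length (snd p) = n}))"

lemma perms_of_length: "{\<pi> \<in> perms. length \<pi> = n} = permutations_of_set {1..n}"
  unfolding perms_def permutations_of_set_def
  by (auto dest: distinct_card)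

lemma finite_perms_of_length: "S \<subseteq> perms \<Longrightarrow> finite {\<pi> \<in> S. length \<pi> = n}"
proof (rule finite_subset)
  show "finite {\<pi> \<in> perms. length \<pi> = n}" unfolding perms_of_length by simp
qed auto

lemma finite_pairs_of_length:
  assumes "T \<subseteq> perms \<times> perms"
  shows "finite {p \<in> T. length (fst p) + length (snd p) = n}"
proof (rule finite_subset)
  show "{p \<in> T. length (fst p) + length (snd p) = n} \<subseteq>
    (\<Union>i\<le>n. {\<pi> \<in> perms. length \<pi> = i}) \<times> (\<Union>i\<le>n. {\<pi> \<in> perms. length \<pi> = i})"
    using assms by auto
qed (auto intro!: finite_perms_of_length)

lemma gf2_Times:
  assumes "A \<subseteq> perms" "B \<subseteq> perms"
  shows "gf2 (A \<times> B) = gf A * gf B"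
proof (rule fps_ext)
  fix n
  have "{p \<in> A \<times> B. length (fst p) + length (snd p) = n} =
    (\<Union>i\<in>{0..n}. {\<pi> \<in> A. length \<pi> = i} \<times> {\<pi> \<in> B. length \<pi> = n - i})"
    by auto
  also have "card \<dots> = (\<Sum>i=0..n. card ({\<pi> \<in> A. length \<pi> = i} \<times> {\<pi> \<in> B. length \<pi> = n - i}))"
    using assms by (intro card_UN_disjoint) (auto intro!: finite_perms_of_length)
  finally show "gf2 (A \<times> B) $ n = (gf A * gf B) $ n"
    by (simp add: gf2_def gf_def fps_mult_nth card_cartesian_product)
qed

lemma gf2_Un:
  assumes "A \<subseteq> perms \<times> perms" "B \<subseteq> perms \<times> perms" "A \<inter> B = {}"
  shows "gf2 (A \<union> B) = gf2 A + gf2 B"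
proof (rule fps_ext)
  fix n
  let ?l = "\<lambda>p :: nat list \<times> nat list. length (fst p) + length (snd p) = n"
  have "{p \<in> A \<union> B. ?l p} = {p \<in> A. ?l p} \<union> {p \<in> B. ?l p}" by blast
  also have "card \<dots> = card {p \<in> A. ?l p} + card {p \<in> B. ?l p}"
    using assms finite_pairs_of_length by (intro card_Un_disjoint) auto
  finally show "gf2 (A \<union> B) $ n = (gf2 A + gf2 B) $ n" by (simp add: gf2_def)
qed

lemma gf_Diff_Nil:
  assumes "A \<subseteq> perms" "[] \<in> A"
  shows "gf (A - {[]}) = gf A - 1"
proof (rule fps_ext)
  fix n
  show "gf (A - {[]}) $ n = (gf A - 1) $ n"
  proof (cases n)
    case 0
    have "{\<pi> \<in> A. length \<pi> = 0} = {[]}" using assms by auto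
    then show ?thesis using 0 by (simp add: gf_def)
  next
    case (Suc k)
    then have "{\<pi> \<in> A - {[]}. length \<pi> = n} = {\<pi> \<in> A. length \<pi> = n}" by auto
    then show ?thesis using Suc by (simp add: gf_def)
  qed
qed

lemma gf_Nil: "gf {[]} = 1"
proof (rule fps_ext)
  fix n
  have "{\<pi> \<in> {[] :: nat list}. length \<pi> = n} = (if n = 0 then {[]} else {})" by auto
  then show "gf {[]} $ n = 1 $ n" by (simp add: gf_def)
qed

text \<open>Every nonempty member is a \<open>glue\<close> or a \<open>glue1\<close> in exactly one
  way. The first adds one letter to the two parts and the second adds two, hence the powers of
  \<open>fps_X\<close>.\<close>

lemma gf_glue_decomposition:
  assumes "S \<subseteq> perms" "\<And>\<pi>. \<pi> \<in> S \<Longrightarrow> count_132 \<pi> \<le> 1"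
  shows "gf S = (if [] \<in> S then 1 else 0) +
    fps_X * gf2 {p \<in> perms \<times> perms. glue (fst p) (snd p) \<in> S} +
    fps_X ^ 2 * gf2 {p \<in> perms \<times> (perms - {[]}). glue1 (fst p) (snd p) \<in> S}"
    (is "_ = _ + _ * gf2 ?T + _ * gf2 ?T1")
proof (rule fps_ext)
  fix n
  show "gf S $ n = ((if [] \<in> S then 1 else 0) + fps_X * gf2 ?T + fps_X ^ 2 * gf2 ?T1) $ n"
  proof (cases n)
    case 0
    have "{\<pi> \<in> S. length \<pi> = 0} = (if [] \<in> S then {[]} else {})" by auto
    then show ?thesis using 0 by (simp add: gf_def fps_X_power_mult_nth)
  next
    case (Suc k)
    define G where "G = {p \<in> ?T. length (fst p) + length (snd p) = k}"
    \<comment> \<open>Writing \<open>+ 1 = k\<close> instead of \<open>= k - 1\<close> makes the set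
      empty for \<open>k = 0\<close>, where truncated subtraction would not.\<close>
    define G1 where "G1 = {p \<in> ?T1. length (fst p) + length (snd p) + 1 = k}"
    have sub: "G \<subseteq> perms \<times> perms" "G1 \<subseteq> perms \<times> perms" by (auto simp: G_def G1_def)
    have "{\<pi> \<in> S. length \<pi> = n} = (\<lambda>(L, R). glue L R) ` G \<union> (\<lambda>(L, R). glue1 L R) ` G1" (is "?L = ?R")
    proof (intro equalityI subsetI)
      fix \<pi> assume \<pi>: "\<pi> \<in> ?L"
      then have "\<pi> \<noteq> []" using Suc by auto
      with perms_cases[of \<pi>] \<pi> assms
      consider L R where "L \<in> perms" "R \<in> perms" "\<pi> = glue L R"
        | L R where "L \<in> perms" "R \<in> perms - {[]}" "\<pi> = glue1 L R" by blast
      then show "\<pi> \<in> ?R"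
      proof cases
        case 1
        then have "(L, R) \<in> G" using \<pi> Suc by (simp add: G_def length_glue)
        with 1 show ?thesis by force
      next
        case 2
        then have "(L, R) \<in> G1" using \<pi> Suc by (simp add: G1_def length_glue1)
        with 2 show ?thesis by force
      qed
    next
      fix \<pi> assume "\<pi> \<in> ?R"
      then show "\<pi> \<in> ?L" using Suc by (auto simp: G_def G1_def length_glue length_glue1)
    qed
    also have "card \<dots> = card ((\<lambda>(L, R). glue L R) ` G) + card ((\<lambda>(L, R). glue1 L R) ` G1)"
    proof (intro card_Un_disjoint)
      show "finite ((\<lambda>(L, R). glue L R) ` G)"
        unfolding G_def by (intro finite_imageI finite_pairs_of_length) auto
      have "G1 = (if k = 0 then {} else {p \<in> ?T1. length (fst p) + length (snd p) = k - 1})"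
        by (auto simp: G1_def)
      moreover have "finite {p \<in> ?T1. length (fst p) + length (snd p) = k - 1}"
        by (intro finite_pairs_of_length) auto
      ultimately show "finite ((\<lambda>(L, R). glue1 L R) ` G1)" by auto
      show "(\<lambda>(L, R). glue L R) ` G \<inter> (\<lambda>(L, R). glue1 L R) ` G1 = {}"
        using sub glue_neq_glue1 by fast
    qed
    also have "\<dots> = card G + card G1"
      using inj_on_subset[OF inj_on_glue sub(1)] inj_on_subset[OF inj_on_glue1 sub(2)]
      by (simp add: card_image)
    finally have "gf S $ n = real (card G) + real (card G1)" by (simp add: gf_def)
    moreover have "(fps_X * gf2 ?T) $ n = real (card G)"
      using Suc by (simp add: gf2_def G_def)
    moreover have "(fps_X ^ 2 * gf2 ?T1) $ n = real (card G1)"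
    proof (cases k)
      case 0
      then have "G1 = {}" by (auto simp: G1_def)
      then show ?thesis using Suc 0 by (simp add: fps_X_power_mult_nth)
    next
      case (Suc k')
      then show ?thesis using \<open>n = Suc k\<close> by (simp add: fps_X_power_mult_nth gf2_def G1_def)
    qed
    ultimately show ?thesis using Suc by simp
  qed
qed

text \<open>The case \<open>m = 0\<close> is adjusted so that, for \<open>j \<le> 1\<close>, \<open>stat m L = j\<close> always describes the left factors
  contributing \<open>j\<close> occurrences of the next pattern. For \<open>m > 0\<close> this needs no correction because an
  occurrence of the longer pattern contains at least two of the shorter one.\<close>

definition stat :: "nat \<Rightarrow> nat list \<Rightarrow> nat" where
  "stat m \<pi> = (if m = 0 then count_21 0 \<pi> + count_21 1 \<pi> else count_21 m \<pi>)"

definition perm_class :: "nat \<Rightarrow> nat \<Rightarrow> nat \<Rightarrow> nat list set" where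
  "perm_class c m j = {\<pi> \<in> perms. count_132 \<pi> = c \<and> stat m \<pi> = j}"

text \<open>In \<open>glue1 L R\<close> the extra letter after \<open>L\<close> creates one more descent, which matters only for \<open>m = 0\<close>.\<close>

definition last_min_class :: "nat \<Rightarrow> nat \<Rightarrow> nat list set" where
  "last_min_class m j = {\<pi> \<in> perms. count_132 \<pi> = 0 \<and> stat m \<pi> + (if m = 0 \<and> \<pi> \<noteq> [] then 1 else 0) = j}"

lemma perm_class_subset: "perm_class c m j \<subseteq> perms" and last_min_class_subset: "last_min_class m j \<subseteq> perms"
  by (auto simp: perm_class_def last_min_class_def)

section \<open>How the statistic splits between the two parts\<close>

lemma stat_Nil: "stat m [] = 0"
  by (simp add: stat_def)

text \<open>For \<open>m > 0\<close> an occurrence of the longer pattern forces at least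
  \<open>Suc m >= 2\<close> of the shorter one. A sum of at most 1 therefore leaves only the second
  summand; for \<open>m = 0\<close> the sum is \<open>stat 0 L\<close> itself.\<close>

lemma count_21_sum_eq_iff:
  assumes "j \<le> 1"
  shows "count_21 (Suc m) L + count_21 m L = j \<longleftrightarrow> stat m L = j"
proof (cases m)
  case 0
  then show ?thesis by (auto simp: stat_def)
next
  case (Suc m')
  with assms count_21_Suc_pos[of m L] show ?thesis by (cases "count_21 (Suc m) L") (simp_all add: stat_def)
qed

text \<open>A descent in \<open>L\<close> counts twice, as a descent and as a 21-3 ending in the
  maximum, so a total of at most 1 makes \<open>L\<close> increasing.\<close>

lemma stat_glue_0_iff:
  assumes "L \<in> perms" "R \<in> perms"
  shows "stat 0 (glue L R) = 0 \<longleftrightarrow> stat 0 L = 0 \<and> R = []"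
    and "stat 0 (glue L R) = 1 \<longleftrightarrow> stat 0 L = 0 \<and> stat 0 R = 0 \<and> R \<noteq> []"
proof -
  have "stat 0 (glue L R) = stat 0 L + count_21 0 L + stat 0 R + (if R = [] then 0 else 1)"
    using count_21_glue[OF assms] by (simp add: stat_def)
  moreover have "count_21 0 L = 0 \<Longrightarrow> stat 0 L = 0"
    using count_21_Suc_pos[of 0 L] by (auto simp: stat_def)
  ultimately show "stat 0 (glue L R) = 0 \<longleftrightarrow> stat 0 L = 0 \<and> R = []"
    "stat 0 (glue L R) = 1 \<longleftrightarrow> stat 0 L = 0 \<and> stat 0 R = 0 \<and> R \<noteq> []"
    by (auto simp: stat_def add_is_1)
qed

text \<open>The maximum starts a descent, and a nonempty \<open>L\<close> adds both a descent and a
  21-3.\<close>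

lemma stat_glue1_0:
  assumes "L \<in> perms" "R \<in> perms" "R \<noteq> []"
  shows "stat 0 (glue1 L R) \<noteq> 0"
    and "stat 0 (glue1 L R) = 1 \<longleftrightarrow> L = [] \<and> stat 0 R = 0"
  using count_21_glue1[OF assms] by (auto simp: stat_def)

lemma stat_glue_Suc_iff:
  assumes "L \<in> perms" "R \<in> perms"
  shows "stat (Suc m) (glue L R) = 0 \<longleftrightarrow> stat m L = 0 \<and> stat (Suc m) R = 0"
    and "stat (Suc m) (glue L R) = 1 \<longleftrightarrow>
      stat m L = 1 \<and> stat (Suc m) R = 0 \<or> stat m L = 0 \<and> stat (Suc m) R = 1"
proof -
  have "stat (Suc m) (glue L R) = (count_21 (Suc m) L + count_21 m L) + stat (Suc m) R"
    using count_21_glue[OF assms, of "Suc m"] by (simp add: stat_def)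
  then show "stat (Suc m) (glue L R) = 0 \<longleftrightarrow> stat m L = 0 \<and> stat (Suc m) R = 0"
    "stat (Suc m) (glue L R) = 1 \<longleftrightarrow> stat m L = 1 \<and> stat (Suc m) R = 0 \<or> stat m L = 0 \<and> stat (Suc m) R = 1"
    using count_21_sum_eq_iff[of 0 m L] count_21_sum_eq_iff[of 1 m L] by linarith+
qed

text \<open>\<open>glue1\<close> already creates one 132, so both parts must avoid it. The
  correction \<open>?e\<close> is the descent from a nonempty \<open>L\<close> completed by the
  maximum to a 21-3.\<close>

lemma glue1_mem_perm_class_Suc_iff:
  assumes "L \<in> perms" "R \<in> perms" "R \<noteq> []"
  shows "glue1 L R \<in> perm_class 1 (Suc m) 0 \<longleftrightarrow> L \<in> last_min_class m 0 \<and> R \<in> perm_class 0 (Suc m) 0"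
    and "glue1 L R \<in> perm_class 1 (Suc m) 1 \<longleftrightarrow>
      L \<in> last_min_class m 1 \<and> R \<in> perm_class 0 (Suc m) 0 \<or> L \<in> last_min_class m 0 \<and> R \<in> perm_class 0 (Suc m) 1"
proof -
  let ?e = "if m = 0 \<and> L \<noteq> [] then 1 else 0 :: nat"
  have "stat (Suc m) (glue1 L R) = (count_21 (Suc m) L + count_21 m L + ?e) + stat (Suc m) R"
    using count_21_glue1[OF assms, of "Suc m"] by (simp add: stat_def)
  moreover have "count_21 (Suc m) L + count_21 m L + ?e = 0 \<longleftrightarrow> stat m L + ?e = 0"
    "count_21 (Suc m) L + count_21 m L + ?e = 1 \<longleftrightarrow> stat m L + ?e = 1"
    using count_21_sum_eq_iff[of 0 m L] count_21_sum_eq_iff[of 1 m L] by auto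
  moreover have "glue1 L R \<in> perms" using glue1_in_perms[OF assms] .
  ultimately show "glue1 L R \<in> perm_class 1 (Suc m) 0 \<longleftrightarrow> L \<in> last_min_class m 0 \<and> R \<in> perm_class 0 (Suc m) 0"
    "glue1 L R \<in> perm_class 1 (Suc m) 1 \<longleftrightarrow>
      L \<in> last_min_class m 1 \<and> R \<in> perm_class 0 (Suc m) 0 \<or> L \<in> last_min_class m 0 \<and> R \<in> perm_class 0 (Suc m) 1"
    using assms count_132_glue1[OF assms] unfolding perm_class_def last_min_class_def mem_Collect_eq One_nat_def
    by (simp_all add: add_is_1) blast+
qed

lemma Nil_mem_perm_class_iff: "[] \<in> perm_class c m j \<longleftrightarrow> c = 0 \<and> j = 0"
  by (auto simp: perm_class_def Nil_in_perms stat_Nil)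

lemma gf_perm_class_decomposition:
  assumes "c \<le> 1"
    and "\<And>L R. L \<in> perms \<Longrightarrow> R \<in> perms \<Longrightarrow> glue L R \<in> perm_class c m j \<longleftrightarrow> (L, R) \<in> T"
    and "\<And>L R. L \<in> perms \<Longrightarrow> R \<in> perms \<Longrightarrow> R \<noteq> [] \<Longrightarrow> glue1 L R \<in> perm_class c m j \<longleftrightarrow> (L, R) \<in> T1"
    and "T \<subseteq> perms \<times> perms" "T1 \<subseteq> perms \<times> (perms - {[]})"
  shows "gf (perm_class c m j) = (if c = 0 \<and> j = 0 then 1 else 0) + fps_X * gf2 T + fps_X ^ 2 * gf2 T1"
proof -
  have "{p \<in> perms \<times> perms. glue (fst p) (snd p) \<in> perm_class c m j} = T"
    using assms(2,4) by auto
  moreover have "{p \<in> perms \<times> (perms - {[]}). glue1 (fst p) (snd p) \<in> perm_class c m j} = T1"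
  proof (intro equalityI subsetI)
    fix p assume "p \<in> T1"
    moreover from this assms(5) have "p \<in> perms \<times> (perms - {[]})" by blast
    ultimately show "p \<in> {p \<in> perms \<times> (perms - {[]}). glue1 (fst p) (snd p) \<in> perm_class c m j}"
      using assms(3) by (cases p) simp
  next
    fix p assume "p \<in> {p \<in> perms \<times> (perms - {[]}). glue1 (fst p) (snd p) \<in> perm_class c m j}"
    then show "p \<in> T1" by (cases p) (auto simp: assms(3))
  qed
  moreover have "\<And>\<pi>. \<pi> \<in> perm_class c m j \<Longrightarrow> count_132 \<pi> \<le> 1" using assms(1) by (simp add: perm_class_def)
  ultimately show ?thesis
    using gf_glue_decomposition[OF perm_class_subset[of c m j]] by (simp add: Nil_mem_perm_class_iff)
qed

section \<open>Functional equations for the four families of classes\<close>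

lemma gf2_empty: "gf2 {} = 0"
  by (rule fps_ext) (simp add: gf2_def)

lemmas mem_perm_class_glue = perm_class_def glue_in_perms count_132_glue

text \<open>Only \<open>glue\<close> contributes to the avoiders, since \<open>glue1\<close> always
  creates a 132.\<close>

lemma gf_av_0_Suc:
  "gf (perm_class 0 (Suc m) 0) = 1 + fps_X * (gf (perm_class 0 m 0) * gf (perm_class 0 (Suc m) 0))"
proof -
  have "gf (perm_class 0 (Suc m) 0) = (if (0::nat) = 0 \<and> (0::nat) = 0 then 1 else 0) +
      fps_X * gf2 (perm_class 0 m 0 \<times> perm_class 0 (Suc m) 0) + fps_X ^ 2 * gf2 {}"
    by (rule gf_perm_class_decomposition)
       (auto simp: mem_perm_class_glue stat_glue_Suc_iff count_132_glue1)
  then show ?thesis by (simp add: gf2_Times perm_class_subset gf2_empty)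
qed

lemma gf_av_1_Suc:
  "gf (perm_class 0 (Suc m) 1) = fps_X * (gf (perm_class 0 m 1) * gf (perm_class 0 (Suc m) 0) +
     gf (perm_class 0 m 0) * gf (perm_class 0 (Suc m) 1))"
proof -
  let ?A = "perm_class 0 m 1 \<times> perm_class 0 (Suc m) 0" and ?B = "perm_class 0 m 0 \<times> perm_class 0 (Suc m) 1"
  have "gf (perm_class 0 (Suc m) 1) = (if (0::nat) = 0 \<and> (1::nat) = 0 then 1 else 0) +
      fps_X * gf2 (?A \<union> ?B) + fps_X ^ 2 * gf2 {}"
    by (rule gf_perm_class_decomposition)
       (auto simp: mem_perm_class_glue stat_glue_Suc_iff[unfolded One_nat_def] count_132_glue1)
  moreover have "gf2 (?A \<union> ?B) = gf2 ?A + gf2 ?B"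
    by (rule gf2_Un) (auto simp: perm_class_def)
  ultimately show ?thesis by (simp add: gf2_Times perm_class_subset gf2_empty)
qed

text \<open>The 132 lies in the left part, in the right part, or arises from \<open>glue1\<close>
  with both parts avoiding it; the last case excludes an empty right part, hence the
  \<open>- 1\<close>.\<close>

lemma gf_one_0_Suc:
  "gf (perm_class 1 (Suc m) 0) = fps_X * (gf (perm_class 1 m 0) * gf (perm_class 0 (Suc m) 0) +
     gf (perm_class 0 m 0) * gf (perm_class 1 (Suc m) 0)) + fps_X ^ 2 * (gf (last_min_class m 0) * (gf (perm_class 0 (Suc m) 0) - 1))"
proof -
  let ?A = "perm_class 1 m 0 \<times> perm_class 0 (Suc m) 0" and ?B = "perm_class 0 m 0 \<times> perm_class 1 (Suc m) 0"
  let ?C = "last_min_class m 0 \<times> (perm_class 0 (Suc m) 0 - {[]})"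
  have "gf (perm_class 1 (Suc m) 0) = (if (1::nat) = 0 \<and> (0::nat) = 0 then 1 else 0) +
      fps_X * gf2 (?A \<union> ?B) + fps_X ^ 2 * gf2 ?C"
  proof (rule gf_perm_class_decomposition)
    fix L R assume LR: "L \<in> perms" "R \<in> perms"
    then show "glue L R \<in> perm_class 1 (Suc m) 0 \<longleftrightarrow> (L, R) \<in> ?A \<union> ?B"
      by (auto simp: mem_perm_class_glue stat_glue_Suc_iff)
    assume "R \<noteq> []"
    with LR show "glue1 L R \<in> perm_class 1 (Suc m) 0 \<longleftrightarrow> (L, R) \<in> ?C"
      using glue1_mem_perm_class_Suc_iff(1)[of L R m] by blast
  qed (auto simp: perm_class_def last_min_class_def)
  moreover have "gf2 (?A \<union> ?B) = gf2 ?A + gf2 ?B"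
    by (rule gf2_Un) (auto simp: perm_class_def)
  moreover have "gf2 ?C = gf (last_min_class m 0) * gf (perm_class 0 (Suc m) 0 - {[]})"
    by (rule gf2_Times) (auto simp: perm_class_def last_min_class_def)
  ultimately show ?thesis by (simp add: gf2_Times perm_class_subset gf_Diff_Nil Nil_mem_perm_class_iff)
qed

text \<open>Under \<open>glue\<close> the 132 and the occurrence of the pattern go to the two parts
  independently, which gives four products; under \<open>glue1\<close> only the pattern remains to
  be placed.\<close>

lemma gf_one_1_Suc:
  "gf (perm_class 1 (Suc m) 1) =
     fps_X * (gf (perm_class 1 m 1) * gf (perm_class 0 (Suc m) 0) + gf (perm_class 1 m 0) * gf (perm_class 0 (Suc m) 1) +
       gf (perm_class 0 m 1) * gf (perm_class 1 (Suc m) 0) + gf (perm_class 0 m 0) * gf (perm_class 1 (Suc m) 1)) +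
     fps_X ^ 2 * (gf (last_min_class m 1) * (gf (perm_class 0 (Suc m) 0) - 1) + gf (last_min_class m 0) * gf (perm_class 0 (Suc m) 1))"
proof -
  let ?A = "perm_class 1 m 1 \<times> perm_class 0 (Suc m) 0" and ?B = "perm_class 1 m 0 \<times> perm_class 0 (Suc m) 1"
  let ?C = "perm_class 0 m 1 \<times> perm_class 1 (Suc m) 0" and ?D = "perm_class 0 m 0 \<times> perm_class 1 (Suc m) 1"
  let ?E = "last_min_class m 1 \<times> (perm_class 0 (Suc m) 0 - {[]})" and ?F = "last_min_class m 0 \<times> perm_class 0 (Suc m) 1"
  have "gf (perm_class 1 (Suc m) 1) = (if (1::nat) = 0 \<and> (1::nat) = 0 then 1 else 0) +
      fps_X * gf2 (?A \<union> ?B \<union> ?C \<union> ?D) + fps_X ^ 2 * gf2 (?E \<union> ?F)"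
  proof (rule gf_perm_class_decomposition)
    fix L R assume LR: "L \<in> perms" "R \<in> perms"
    then show "glue L R \<in> perm_class 1 (Suc m) 1 \<longleftrightarrow> (L, R) \<in> ?A \<union> ?B \<union> ?C \<union> ?D"
      unfolding mem_perm_class_glue mem_Collect_eq Un_iff mem_Times_iff fst_conv snd_conv
        stat_glue_Suc_iff[OF LR] count_132_glue[OF LR]
      using glue_in_perms[OF LR] LR add_is_1[of "count_132 L" "count_132 R"] by (simp del: add_is_1) blast
    assume "R \<noteq> []"
    with LR show "glue1 L R \<in> perm_class 1 (Suc m) 1 \<longleftrightarrow> (L, R) \<in> ?E \<union> ?F"
      using glue1_mem_perm_class_Suc_iff(2)[of L R m] by blast
  next
    show "?E \<union> ?F \<subseteq> perms \<times> (perms - {[]})"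
      by (auto simp: perm_class_def last_min_class_def stat_Nil)
  qed (use perm_class_subset in auto)
  moreover have "gf2 (?A \<union> ?B \<union> ?C \<union> ?D) = gf2 (?A \<union> ?B \<union> ?C) + gf2 ?D"
    "gf2 (?A \<union> ?B \<union> ?C) = gf2 (?A \<union> ?B) + gf2 ?C" "gf2 (?A \<union> ?B) = gf2 ?A + gf2 ?B"
    "gf2 (?E \<union> ?F) = gf2 ?E + gf2 ?F"
    by (rule gf2_Un; auto simp: perm_class_def last_min_class_def)+
  moreover have "gf2 ?E = gf (last_min_class m 1) * gf (perm_class 0 (Suc m) 0 - {[]})"
    by (rule gf2_Times) (auto simp: perm_class_def last_min_class_def)
  ultimately show ?thesis
    by (simp add: gf2_Times perm_class_subset last_min_class_subset gf_Diff_Nil Nil_mem_perm_class_iff)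
qed

text \<open>This class consists of the increasing permutations, so the solution is the geometric
  series.\<close>

lemma gf_av_0_0: "gf (perm_class 0 0 0) = 1 + fps_X * gf (perm_class 0 0 0)"
proof -
  have "gf (perm_class 0 0 0) = (if (0::nat) = 0 \<and> (0::nat) = 0 then 1 else 0) +
      fps_X * gf2 (perm_class 0 0 0 \<times> {[]}) + fps_X ^ 2 * gf2 {}"
    by (rule gf_perm_class_decomposition)
       (auto simp: mem_perm_class_glue stat_glue_0_iff count_132_glue1 Nil_in_perms)
  then show ?thesis by (simp add: gf2_Times perm_class_subset gf2_empty gf_Nil Nil_in_perms)
qed

lemma gf_av_1_0: "gf (perm_class 0 0 1) = fps_X * (gf (perm_class 0 0 0) * (gf (perm_class 0 0 0) - 1))"
proof -
  let ?A = "perm_class 0 0 0 \<times> (perm_class 0 0 0 - {[]})"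
  have "gf (perm_class 0 0 1) = (if (0::nat) = 0 \<and> (1::nat) = 0 then 1 else 0) +
      fps_X * gf2 ?A + fps_X ^ 2 * gf2 {}"
    by (rule gf_perm_class_decomposition)
       (auto simp: mem_perm_class_glue stat_glue_0_iff[unfolded One_nat_def] count_132_glue1)
  moreover have "gf2 ?A = gf (perm_class 0 0 0) * gf (perm_class 0 0 0 - {[]})"
    by (rule gf2_Times) (auto simp: perm_class_def)
  ultimately show ?thesis by (simp add: perm_class_subset gf2_empty gf_Diff_Nil Nil_mem_perm_class_iff)
qed

lemma gf_one_0_0: "gf (perm_class 1 0 0) = 0"
proof -
  have "gf (perm_class 1 0 0) = (if (1::nat) = 0 \<and> (0::nat) = 0 then 1 else 0) +
      fps_X * gf2 (perm_class 1 0 0 \<times> {[]}) + fps_X ^ 2 * gf2 {}"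
    by (rule gf_perm_class_decomposition)
       (auto simp: mem_perm_class_glue stat_glue_0_iff stat_glue1_0 Nil_in_perms)
  then have "gf (perm_class 1 0 0) * (1 - fps_X) = 0"
    by (simp add: gf2_Times perm_class_subset gf2_empty gf_Nil Nil_in_perms algebra_simps)
  moreover have "1 - fps_X \<noteq> (0 :: real fps)"
    by (metis eq_iff_diff_eq_0 fps_X_neq_one)
  ultimately show ?thesis by simp
qed

text \<open>Only \<open>glue1\<close> with empty \<open>L\<close> and nonempty increasing
  \<open>R\<close> survives, because a permutation without descents contains no 132.\<close>

lemma gf_one_1_0: "gf (perm_class 1 0 1) = fps_X ^ 2 * (gf (perm_class 0 0 0) - 1)"
proof -
  let ?A = "perm_class 1 0 0 \<times> (perm_class 0 0 0 - {[]})" and ?B = "perm_class 0 0 0 \<times> perm_class 1 0 0"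
  let ?C = "{[]} \<times> (perm_class 0 0 0 - {[]})"
  have "gf (perm_class 1 0 1) = (if (1::nat) = 0 \<and> (1::nat) = 0 then 1 else 0) +
      fps_X * gf2 (?A \<union> ?B) + fps_X ^ 2 * gf2 ?C"
  proof (rule gf_perm_class_decomposition)
    fix L R assume LR: "L \<in> perms" "R \<in> perms"
    then show "glue L R \<in> perm_class 1 0 1 \<longleftrightarrow> (L, R) \<in> ?A \<union> ?B"
      by (auto simp: mem_perm_class_glue stat_glue_0_iff[unfolded One_nat_def])
    assume "R \<noteq> []"
    with LR show "glue1 L R \<in> perm_class 1 0 1 \<longleftrightarrow> (L, R) \<in> ?C"
      by (auto simp: perm_class_def stat_glue1_0[unfolded One_nat_def] count_132_glue1 glue1_in_perms)
  qed (auto simp: perm_class_def Nil_in_perms)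
  moreover have "gf2 (?A \<union> ?B) = gf2 ?A + gf2 ?B"
    by (rule gf2_Un) (auto simp: perm_class_def)
  moreover have "gf2 ?A = gf (perm_class 1 0 0) * gf (perm_class 0 0 0 - {[]})"
    "gf2 ?C = gf {[]} * gf (perm_class 0 0 0 - {[]})"
    by (rule gf2_Times; auto simp: perm_class_def Nil_in_perms)+
  ultimately show ?thesis
    by (simp add: gf2_Times perm_class_subset gf_Diff_Nil Nil_mem_perm_class_iff gf_one_0_0 gf_Nil
        del: One_nat_def)
qed

text \<open>For \<open>m = 0\<close> the extra descent makes the value 0 possible only for the empty
  list, and the value 1 only for nonempty increasing permutations.\<close>

lemma gf_last_min_class:
  "gf (last_min_class 0 0) = 1" "gf (last_min_class 0 1) = gf (perm_class 0 0 0) - 1" "gf (last_min_class (Suc m) j) = gf (perm_class 0 (Suc m) j)"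
proof -
  have "last_min_class 0 0 = {[]}" by (auto simp: last_min_class_def Nil_in_perms stat_Nil)
  then show "gf (last_min_class 0 0) = 1" by (simp add: gf_Nil)
  have "last_min_class 0 1 = perm_class 0 0 0 - {[]}" by (auto simp: last_min_class_def perm_class_def stat_Nil)
  then show "gf (last_min_class 0 1) = gf (perm_class 0 0 0) - 1"
    by (simp add: gf_Diff_Nil perm_class_subset Nil_mem_perm_class_iff)
  show "gf (last_min_class (Suc m) j) = gf (perm_class 0 (Suc m) j)" by (simp add: last_min_class_def perm_class_def)
qed

lemma Phi_eq_gf: "\<Phi> (pattern_21_3_to (Suc m + 2)) = gf (perm_class 1 (Suc m) 1)"
proof -
  have "{\<pi> \<in> permutations_of_set {1..n}. card (occurrences pattern_132 \<pi>) = 1 \<and>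
      card (occurrences (pattern_21_3_to (Suc m + 2)) \<pi>) = 1} = {\<pi> \<in> perm_class 1 (Suc m) 1. length \<pi> = n}" for n
    unfolding card_occurrences_pattern_132 card_occurrences_pattern_21_3_to perms_of_length[symmetric]
    by (auto simp: perm_class_def stat_def)
  then show ?thesis unfolding \<Phi>_def \<phi>_def gf_def by presburger
qed

subsection \<open>Solving the recurrences\<close>

text \<open>The induction step for \<open>g\<close> as a rational identity: \<open>p\<close> is a
  power of \<open>x\<close>, \<open>v\<close>, \<open>w\<close>, \<open>z\<close> are consecutive
  values of \<open>u\<close>, and \<open>T\<close>, \<open>S\<close> are partial sums of the
  solution. In \<open>f\<close> the inner sum ends one term earlier, hence the subtracted
  quotient.\<close>

lemma one_occurrence_step_identity:
  fixes x p v w z T S :: "'a::field"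
  assumes nz: "x \<noteq> 0" "p \<noteq> 0" "w \<noteq> 0" "z \<noteq> 0" and z: "z = w - x * v" and cassini: "w\<^sup>2 - v * z = x * p"
    and f: "f = p * x\<^sup>2 * (T - v\<^sup>2 / p - 1) / w\<^sup>2" and f': "f' = p * x ^ 3 * (T - 1) / z\<^sup>2"
    and g: "g = 2 * p * x\<^sup>2 / w\<^sup>2 * S"
  shows "(w / z) * (x * (g * (w / z) + f * (p * x\<^sup>2 / z\<^sup>2) + (p * x / w\<^sup>2) * f') +
      x\<^sup>2 * ((p * x / w\<^sup>2) * (w / z - 1) + (v / w) * (p * x\<^sup>2 / z\<^sup>2))) =
    2 * p * x ^ 3 / z\<^sup>2 * (S + p * x\<^sup>2 / (w * z) * (T + w\<^sup>2 / (p * x) - 2))" (is "?l = ?r")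
proof -
  \<comment> \<open>The \<open>S\<close> terms of both sides agree, and
    \<open>p * x ^ 3 / (w * z ^ 3)\<close> factors out of the rest. \<open>A\<close> and
    \<open>B\<close> are the cofactors, equal by the recursion for \<open>z\<close> and the Cassini
    relation.\<close>
  define A where "A = p * x\<^sup>2 * (T - 1) - x\<^sup>2 * v\<^sup>2 + p * x\<^sup>2 * (T - 1) + (w - z) * z + x * v * w"
  define B where "B = 2 * (p * x\<^sup>2 * (T - 2) + x * w\<^sup>2)"
  have "A = B"
    unfolding A_def B_def using z cassini by algebra
  have "?l = 2 * p * x ^ 3 / z\<^sup>2 * S + p * x ^ 3 / (w * z ^ 3) * A"
    unfolding f f' g A_def using nz
    by (simp add: divide_simps) (simp add: algebra_simps power2_eq_square power3_eq_cube)
  moreover have "?r = 2 * p * x ^ 3 / z\<^sup>2 * S + p * x ^ 3 / (w * z ^ 3) * B"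
    unfolding B_def using nz
    by (simp add: divide_simps) (simp add: algebra_simps power2_eq_square power3_eq_cube)
  ultimately show ?thesis using \<open>A = B\<close> by simp
qed

text \<open>\<open>a\<close>, \<open>b\<close>, \<open>f\<close>, \<open>g\<close> stand for the
  classes with (0,0), (0,1), (1,0), (1,1) occurrences of 132 and of the pattern; \<open>u\<close> is
  the rescaled Chebyshev sequence.\<close>

lemma solve_one_occurrence_recurrence:
  fixes x :: "'a::field" and u a b f g :: "nat \<Rightarrow> 'a"
  assumes x: "x \<noteq> 0"
    and u: "u 0 = 1" "u 1 = 1" "\<And>i. u (Suc (Suc i)) = u (Suc i) - x * u i"
    and a: "a 0 = 1 + x * a 0" "\<And>m. a (Suc m) = 1 + x * (a m * a (Suc m))"
    and b: "b 0 = x * (a 0 * (a 0 - 1))" "\<And>m. b (Suc m) = x * (b m * a (Suc m) + a m * b (Suc m))"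
    and f: "f 0 = 0" "f (Suc 0) = x * (f 0 * a (Suc 0) + a 0 * f (Suc 0)) + x\<^sup>2 * (a (Suc 0) - 1)"
      "\<And>m. f (Suc (Suc m)) = x * (f (Suc m) * a (Suc (Suc m)) + a (Suc m) * f (Suc (Suc m))) +
         x\<^sup>2 * (a (Suc m) * (a (Suc (Suc m)) - 1))"
    and g: "g 0 = x\<^sup>2 * (a 0 - 1)"
      "g (Suc 0) = x * (g 0 * a (Suc 0) + f 0 * b (Suc 0) + b 0 * f (Suc 0) + a 0 * g (Suc 0)) +
         x\<^sup>2 * ((a 0 - 1) * (a (Suc 0) - 1) + b (Suc 0))"
      "\<And>m. g (Suc (Suc m)) = x * (g (Suc m) * a (Suc (Suc m)) + f (Suc m) * b (Suc (Suc m)) +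
           b (Suc m) * f (Suc (Suc m)) + a (Suc m) * g (Suc (Suc m))) +
         x\<^sup>2 * (b (Suc m) * (a (Suc (Suc m)) - 1) + a (Suc m) * b (Suc (Suc m)))"
  shows "u i \<noteq> 0"
    and "g (Suc m) = 2 * x ^ (m + 4) / (u (m + 3))\<^sup>2 *
      ((u 2)\<^sup>2 / u 3 + (\<Sum>i=3..m + 2. x ^ (i + 1) / (u i * u (i + 1)) * ((\<Sum>j=1..i. (u j)\<^sup>2 / x ^ j) - 2)))"
proof -
  have u2: "u 2 = 1 - x" using u(3)[of 0] u(1,2) by (simp add: numeral_2_eq_2)
  have u3: "u 3 = 1 - 2 * x" using u(3)[of 1] u(2) u2 by (simp add: numeral_2_eq_2 numeral_3_eq_3)
  \<comment> \<open>Nonvanishing is proved together with the formula: \<open>u (m + 3)\<close> is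
    \<open>u (m + 2)\<close> times \<open>1 - x * a m\<close>, which is invertible with inverse
    \<open>a (Suc m)\<close>.\<close>
  have ua: "u (m + 2) \<noteq> 0 \<and> a m * u (m + 2) = u (m + 1)" for m
  proof (induction m)
    case 0
    have "a 0 * u 2 = 1" using a(1) u2 by algebra
    then show ?case using u(2) by (metis One_nat_def add_0 mult_zero_right zero_neq_one)
  next
    case (Suc m)
    have eq: "u (Suc m + 2) = u (m + 2) * (1 - x * a m)"
      using u(3)[of "m + 1"] Suc by (simp add: algebra_simps)
    have inv: "a (Suc m) * (1 - x * a m) = 1" using a(2)[of m] by (simp add: algebra_simps)
    then have "1 - x * a m \<noteq> 0" by auto
    then have "u (Suc m + 2) \<noteq> 0" using eq Suc by simp
    moreover have "a (Suc m) * u (Suc m + 2) = u (m + 2) * (a (Suc m) * (1 - x * a m))"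
      unfolding eq by (simp only: mult_ac)
    then have "a (Suc m) * u (Suc m + 2) = u (Suc m + 1)" by (simp add: inv)
    ultimately show ?case ..
  qed
  have nz: "u i \<noteq> 0" for i
  proof -
    consider "i = 0" | "i = 1" | "i = (i - 2) + 2" by linarith
    then show ?thesis
    proof cases
      case 3
      then show ?thesis using ua[of "i - 2"] by metis
    qed (use u in simp_all)
  qed
  show "u i \<noteq> 0" by (rule nz)
  have a_eq: "a m = u (m + 1) / u (m + 2)" for m
    using ua[of m] by (simp add: field_simps)
  \<comment> \<open>Each recurrence is linear in its new term with coefficient
    \<open>x * a m\<close>, so solving it means multiplying the remainder by
    \<open>a (Suc m)\<close>.\<close>
  have solve: "y = a (Suc m) * r" if "y = x * a m * y + r" for y r m
  proof -
    have "a (Suc m) * (1 - x * a m) = 1" using a(2)[of m] by (simp add: algebra_simps)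
    moreover have "y * (1 - x * a m) = r" using that by (simp add: algebra_simps)
    ultimately show ?thesis by (metis mult.commute mult.left_commute mult_1)
  qed
  have b_eq: "b m = x ^ (m + 2) / (u (m + 2))\<^sup>2" for m
  proof (induction m)
    case 0
    have "b 0 = x * (a 0 * (x * a 0))" using a(1) b(1) by algebra
    then show ?case using u(2) by (simp add: a_eq[of 0] power2_eq_square)
  next
    case (Suc m)
    have "b (Suc m) = a (Suc m) * (x * b m * a (Suc m))"
      by (rule solve) (use b(2)[of m] in \<open>simp add: algebra_simps\<close>)
    then show ?case
      using nz[of "m + 2"] by (simp add: Suc a_eq[of "Suc m"] power2_eq_square)
  qed
  \<comment> \<open>The determinant on the left starts at \<open>1 - (1 - x) = x\<close> and gains a
    factor \<open>x\<close> with every step.\<close>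
  have cassini: "(u (Suc i))\<^sup>2 - u i * u (Suc (Suc i)) = x ^ Suc i" for i
  proof (induction i)
    case 0
    then show ?case using u u(3)[of 0] by simp
  next
    case (Suc i)
    have "(u (Suc (Suc i)))\<^sup>2 - u (Suc i) * u (Suc (Suc (Suc i))) =
        x * ((u (Suc i))\<^sup>2 - u i * u (Suc (Suc i)))"
      unfolding u(3)[of "Suc i"] u(3)[of i] by algebra
    then show ?case using Suc by simp
  qed
  have d: "u 2 / u 3 - 1 = x / u 3"
  proof -
    have "u 2 = u 3 + x" by (simp add: u2 u3)
    then show ?thesis using nz[of 3] by (simp add: add_divide_distrib)
  qed
  define T where "T n = (\<Sum>j=1..n. (u j)\<^sup>2 / x ^ j)" for n
  have T_Suc: "T (Suc n) = T n + (u (Suc n))\<^sup>2 / x ^ Suc n" for n by (simp add: T_def)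
  \<comment> \<open>\<open>T 1 = 1 / x\<close>, which brings the base value of \<open>f\<close> into
    the general form.\<close>
  have T_1: "x ^ 4 * (T 1 - 1) = u 2 * x ^ 3"
    using x u(2) unfolding u2 by (simp add: T_def field_simps power3_eq_cube power4_eq_xxxx)
  have f_eq: "f (Suc m) = x ^ (m + 4) * (T (m + 1) - 1) / (u (m + 3))\<^sup>2" for m
  proof (induction m)
    case 0
    have "f (Suc 0) = a (Suc 0) * (x\<^sup>2 * (a (Suc 0) - 1))"
      by (rule solve) (use f(2) f(1) in \<open>simp add: algebra_simps\<close>)
    also have "a (Suc 0) = u 2 / u 3" using a_eq[of "Suc 0"] by (simp add: numeral_2_eq_2 numeral_3_eq_3)
    also have "u 2 / u 3 - 1 = x / u 3" by (rule d)
    finally have "f (Suc 0) = u 2 * x ^ 3 / (u 3)\<^sup>2" by (simp add: power2_eq_square power3_eq_cube)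
    with T_1 show ?case by simp
  next
    case (Suc m)
    let ?v = "u (m + 2)" and ?w = "u (m + 3)" and ?z = "u (m + 4)"
    have z: "?z = ?w - x * ?v" using u(3)[of "m + 2"] by (simp add: eval_nat_numeral)
    have "f (Suc (Suc m)) = a (Suc (Suc m)) * (x * f (Suc m) * a (Suc (Suc m)) +
        x\<^sup>2 * (a (Suc m) * (a (Suc (Suc m)) - 1)))"
      by (rule solve) (use f(3)[of m] in \<open>simp add: algebra_simps\<close>)
    also have "a (Suc (Suc m)) = ?w / ?z" using a_eq[of "Suc (Suc m)"] by (simp add: eval_nat_numeral)
    also have "a (Suc m) = ?v / ?w" using a_eq[of "Suc m"] by (simp add: eval_nat_numeral)
    also have "?w / ?z - 1 = (?w - ?z) / ?z" using nz[of "m + 4"] by (simp add: diff_divide_distrib)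
    also have "?w - ?z = x * ?v" using z by simp
    also have "?w / ?z * (x * f (Suc m) * (?w / ?z) + x\<^sup>2 * (?v / ?w * (x * ?v / ?z))) =
       (x * f (Suc m) * ?w\<^sup>2 + x ^ 3 * ?v\<^sup>2) / ?z\<^sup>2"
      using nz[of "m + 3"] nz[of "m + 4"] by (simp add: field_simps power2_eq_square power3_eq_cube)
    also have "x * f (Suc m) * ?w\<^sup>2 = x * x ^ (m + 4) * (T (m + 1) - 1)"
      using nz[of "m + 3"] Suc by simp
    \<comment> \<open>The term gained by \<open>f\<close> is exactly the next summand of
      \<open>T\<close>, scaled by the common power of \<open>x\<close>.\<close>
    also have "x * x ^ (m + 4) * (T (m + 1) - 1) + x ^ 3 * ?v\<^sup>2 = x ^ (Suc m + 4) * (T (Suc m + 1) - 1)"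
    proof -
      have pow: "x * x ^ (m + 4) = x ^ 3 * x ^ (m + 2)" "x ^ (Suc m + 4) = x ^ 3 * x ^ (m + 2)"
        by (simp_all add: power_add eval_nat_numeral mult_ac)
      have T: "T (Suc m + 1) = T (m + 1) + ?v\<^sup>2 / x ^ (m + 2)" using T_Suc[of "m + 1"] by simp
      have "x ^ 3 * x ^ (m + 2) * (?v\<^sup>2 / x ^ (m + 2)) = x ^ 3 * ?v\<^sup>2" using x by simp
      moreover have "A * (B - 1) + D = A * (B + C - 1)" if "A * C = D" for A B C D :: 'a
        using that by (simp add: algebra_simps)
      ultimately show ?thesis unfolding pow T by blast
    qed
    finally show ?case by (simp add: eval_nat_numeral)
  qed
  define S where "S m = (u 2)\<^sup>2 / u 3 + (\<Sum>i=3..m + 2. x ^ (i + 1) / (u i * u (i + 1)) * (T i - 2))" for m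
  have S_Suc: "S (Suc m) = S m + x ^ (m + 4) / (u (m + 3) * u (m + 4)) * (T (m + 3) - 2)" for m
    by (simp add: S_def eval_nat_numeral)
  have "g (Suc m) = 2 * x ^ (m + 4) / (u (m + 3))\<^sup>2 * S m" for m
  proof (induction m)
    case 0
    have a0: "a 0 = 1 / u 2" using a_eq[of 0] u(2) by (simp add: numeral_2_eq_2)
    have a1: "a (Suc 0) = u 2 / u 3" using a_eq[of "Suc 0"] by (simp add: numeral_2_eq_2 numeral_3_eq_3)
    have d0: "a 0 - 1 = x / u 2"
    proof -
      have "a 0 - 1 = (1 - u 2) / u 2" using nz[of 2] by (simp add: a0 diff_divide_distrib)
      then show ?thesis by (simp add: u2)
    qed
    have d1: "a (Suc 0) - 1 = x / u 3" unfolding a1 by (rule d)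
    have b0: "b 0 = x\<^sup>2 / (u 2)\<^sup>2" using b_eq[of 0] by (simp only: add_0)
    have b1: "b (Suc 0) = x ^ 3 / (u 3)\<^sup>2" using b_eq[of "Suc 0"] by (simp add: numeral_2_eq_2 numeral_3_eq_3)
    have f1: "f (Suc 0) = u 2 * x ^ 3 / (u 3)\<^sup>2" using f_eq[of 0] T_1 by simp
    have "g (Suc 0) = a (Suc 0) * (x * (g 0 * a (Suc 0) + b 0 * f (Suc 0)) +
         x\<^sup>2 * ((a 0 - 1) * (a (Suc 0) - 1) + b (Suc 0)))"
      by (rule solve) (use g(2) f(1) in \<open>simp add: algebra_simps\<close>)
    also have "\<dots> = x ^ 4 / (u 3) ^ 3 * (u 2 * u 3 + x\<^sup>2 + u 3 + x * u 2)"
      unfolding g(1) d0 d1 unfolding a1 b0 f1 b1 using nz[of 2] nz[of 3]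
      by (simp add: divide_simps) (simp add: algebra_simps power2_eq_square power3_eq_cube power4_eq_xxxx)
    \<comment> \<open>Both sides are \<open>2 * (1 - x)\<close> times \<open>1 - x\<close>. This
      produces the leading factor 2 and the isolated first term of the formula.\<close>
    also have "u 2 * u 3 + x\<^sup>2 + u 3 + x * u 2 = 2 * (u 2)\<^sup>2"
      unfolding u2 u3 by (simp add: algebra_simps power2_eq_square)
    finally show ?case using nz[of 3] by (simp add: S_def field_simps power2_eq_square power3_eq_cube)
  next
    case (Suc m)
    let ?v = "u (m + 2)" and ?w = "u (m + 3)" and ?z = "u (m + 4)" and ?p = "x ^ (m + 2)"
    have z: "?z = ?w - x * ?v" using u(3)[of "m + 2"] by (simp add: eval_nat_numeral)
    have cas: "?w\<^sup>2 - ?v * ?z = x * ?p" using cassini[of "m + 2"] by (simp add: eval_nat_numeral)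
    have a': "a (Suc (Suc m)) = ?w / ?z" using a_eq[of "Suc (Suc m)"] by (simp add: eval_nat_numeral)
    have a: "a (Suc m) = ?v / ?w" using a_eq[of "Suc m"] by (simp add: eval_nat_numeral)
    have b': "b (Suc (Suc m)) = ?p * x\<^sup>2 / ?z\<^sup>2" using b_eq[of "Suc (Suc m)"] by (simp add: eval_nat_numeral mult_ac)
    have b: "b (Suc m) = ?p * x / ?w\<^sup>2" using b_eq[of "Suc m"] by (simp add: eval_nat_numeral mult_ac)
    have f': "f (Suc (Suc m)) = ?p * x ^ 3 * (T (m + 2) - 1) / ?z\<^sup>2"
      using f_eq[of "Suc m"] by (simp add: eval_nat_numeral mult_ac)
    have f: "f (Suc m) = ?p * x\<^sup>2 * (T (m + 2) - ?v\<^sup>2 / ?p - 1) / ?w\<^sup>2"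
      using f_eq[of m] T_Suc[of "m + 1"] by (simp add: eval_nat_numeral mult_ac)
    have g_m: "g (Suc m) = 2 * ?p * x\<^sup>2 / ?w\<^sup>2 * S m"
      using Suc by (simp add: eval_nat_numeral mult_ac)
    have "g (Suc (Suc m)) = a (Suc (Suc m)) * (x * (g (Suc m) * a (Suc (Suc m)) +
          f (Suc m) * b (Suc (Suc m)) + b (Suc m) * f (Suc (Suc m))) +
         x\<^sup>2 * (b (Suc m) * (a (Suc (Suc m)) - 1) + a (Suc m) * b (Suc (Suc m))))"
      by (rule solve) (use g(3)[of m] in \<open>simp add: algebra_simps\<close>)
    also have "\<dots> = 2 * ?p * x ^ 3 / ?z\<^sup>2 * (S m + ?p * x\<^sup>2 / (?w * ?z) * (T (m + 2) + ?w\<^sup>2 / (?p * x) - 2))"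
      unfolding a' a b' b
      by (rule one_occurrence_step_identity[OF x _ nz nz z cas f f' g_m]) (use x in simp)
    also have "T (m + 2) + ?w\<^sup>2 / (?p * x) = T (m + 3)"
      using T_Suc[of "m + 2"] by (simp add: eval_nat_numeral mult_ac)
    also have "S m + ?p * x\<^sup>2 / (?w * ?z) * (T (m + 3) - 2) = S (Suc m)"
      unfolding S_Suc by (simp add: eval_nat_numeral mult_ac)
    finally show ?case by (simp add: eval_nat_numeral mult_ac)
  qed
  then show "g (Suc m) = 2 * x ^ (m + 4) / (u (m + 3))\<^sup>2 *
      ((u 2)\<^sup>2 / u 3 + (\<Sum>i=3..m + 2. x ^ (i + 1) / (u i * u (i + 1)) * ((\<Sum>j=1..i. (u j)\<^sup>2 / x ^ j) - 2)))"
    unfolding S_def T_def .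
qed

section \<open>Chebyshev polynomials and power series in the field of Laurent series\<close>

lemma U_rec:
  "U 0 t = 1" "U (Suc 0) t = 2 * t" "U (Suc (Suc p)) t = 2 * t * U (Suc p) t - U p t"
proof -
  have diff: "map_poly fls_const (p - q) = map_poly fls_const p - map_poly fls_const q" for p q :: "real poly"
    by (intro poly_eqI) (simp add: coeff_map_poly fls_minus_const)
  have mult: "map_poly fls_const ([:0, 2:] * p) = [:0, 2:] * map_poly fls_const p" for p :: "real poly"
    by (intro poly_eqI)
       (simp add: coeff_map_poly coeff_pCons flip: fls_const_mult_const split: nat.split)
  show "U 0 t = 1" "U (Suc 0) t = 2 * t" "U (Suc (Suc p)) t = 2 * t * U (Suc p) t - U p t"
    unfolding U_def chebyshev_U_eq_rec chebyshev_U_rec.simps diff mult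
    by (simp_all add: map_poly_pCons)
qed

text \<open>A ring homomorphism into a field in which \<open>x\<close> becomes the square of
  \<open>fls_X\<close>; the recurrences survive and may be divided by.\<close>

definition subst_sq :: "real fps \<Rightarrow> real fls" where
  "subst_sq F = fps_to_fls (F oo fps_X ^ 2)"

lemma subst_sq_hom:
  "subst_sq (F + G) = subst_sq F + subst_sq G" "subst_sq (F - G) = subst_sq F - subst_sq G"
  "subst_sq (F * G) = subst_sq F * subst_sq G" "subst_sq 1 = 1" "subst_sq 0 = 0"
  "subst_sq fps_X = fls_X ^ 2"
  by (simp_all add: subst_sq_def fps_compose_add_distrib fps_compose_sub_distrib
      fps_compose_mult_distrib fls_times_fps_to_fls fps_to_fls_power)

lemma subst_sq_power: "subst_sq (F ^ n) = subst_sq F ^ n"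
  by (induction n) (simp_all add: subst_sq_hom)

(* The formal variable of the Laurent series is the square root of x, so that x is its square. *)
theorem theorem5p2:
  fixes k :: nat and sqrt_x t :: "real fls"
  assumes "k \<ge> 3"
    and "sqrt_x = fls_X"
    and "t = 1 / (2 * sqrt_x)"
  shows "fps_to_fls (\<Phi> (pattern_21_3_to k) oo fps_X ^ 2) =
    1 / (4 * t ^ 3 * (U k t)\<^sup>2) *
      ((U 2 t)\<^sup>2 / U 3 t +
       (\<Sum>i = 3..k - 1. 1 / (U i t * U (i + 1) t) * ((\<Sum>j = 1..i. (U j t)\<^sup>2) - 2)))"
proof -
  define x where "x = sqrt_x\<^sup>2"
  have s: "sqrt_x \<noteq> 0" using assms(2) by simp
  then have x: "x \<noteq> 0" by (simp add: x_def)
  have X: "subst_sq fps_X = x" by (simp add: subst_sq_hom x_def assms(2))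
  \<comment> \<open>The power of \<open>sqrt_x\<close> cancels \<open>2 * t = 1 / sqrt_x\<close> in
    the Chebyshev recursion and leaves \<open>x\<close> as the only parameter.\<close>
  define u where "u i = sqrt_x ^ i * U i t" for i
  have u: "u 0 = 1" "u 1 = 1" "u (Suc (Suc i)) = u (Suc i) - x * u i" for i
    using s by (simp_all add: u_def U_rec assms(3) x_def field_simps power2_eq_square)
  define a b f g where "a m = subst_sq (gf (perm_class 0 m 0))" and "b m = subst_sq (gf (perm_class 0 m 1))"
    and "f m = subst_sq (gf (perm_class 1 m 0))" and "g m = subst_sq (gf (perm_class 1 m 1))" for m
  note hom = subst_sq_hom(1-5) subst_sq_power X gf_last_min_class a_def[symmetric] b_def[symmetric] f_def[symmetric] g_def[symmetric]
  have recs: "a 0 = 1 + x * a 0" "a (Suc m) = 1 + x * (a m * a (Suc m))"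
    "b 0 = x * (a 0 * (a 0 - 1))" "b (Suc m) = x * (b m * a (Suc m) + a m * b (Suc m))"
    "f 0 = 0" "f (Suc 0) = x * (f 0 * a (Suc 0) + a 0 * f (Suc 0)) + x\<^sup>2 * (a (Suc 0) - 1)"
    "f (Suc (Suc m)) = x * (f (Suc m) * a (Suc (Suc m)) + a (Suc m) * f (Suc (Suc m))) +
         x\<^sup>2 * (a (Suc m) * (a (Suc (Suc m)) - 1))"
    "g 0 = x\<^sup>2 * (a 0 - 1)"
    "g (Suc 0) = x * (g 0 * a (Suc 0) + f 0 * b (Suc 0) + b 0 * f (Suc 0) + a 0 * g (Suc 0)) +
         x\<^sup>2 * ((a 0 - 1) * (a (Suc 0) - 1) + b (Suc 0))"
    "g (Suc (Suc m)) = x * (g (Suc m) * a (Suc (Suc m)) + f (Suc m) * b (Suc (Suc m)) +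
           b (Suc m) * f (Suc (Suc m)) + a (Suc m) * g (Suc (Suc m))) +
         x\<^sup>2 * (b (Suc m) * (a (Suc (Suc m)) - 1) + a (Suc m) * b (Suc (Suc m)))" for m
    using gf_av_0_0[THEN arg_cong[of _ _ subst_sq]] gf_av_0_Suc[of m, THEN arg_cong[of _ _ subst_sq]]
      gf_av_1_0[THEN arg_cong[of _ _ subst_sq]] gf_av_1_Suc[of m, THEN arg_cong[of _ _ subst_sq]]
      gf_one_0_0[THEN arg_cong[of _ _ subst_sq]] gf_one_0_Suc[of 0, THEN arg_cong[of _ _ subst_sq]]
      gf_one_0_Suc[of "Suc m", THEN arg_cong[of _ _ subst_sq]]
      gf_one_1_0[THEN arg_cong[of _ _ subst_sq]] gf_one_1_Suc[of 0, THEN arg_cong[of _ _ subst_sq]]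
      gf_one_1_Suc[of "Suc m", THEN arg_cong[of _ _ subst_sq]]
    unfolding hom mult_1 .
  define m where "m = k - 3"
  have k: "k = m + 3" using assms(1) by (simp add: m_def)
  note sol = solve_one_occurrence_recurrence[where u = u and a = a and b = b and f = f and g = g,
      OF x u recs]
  have U: "U i t = u i / sqrt_x ^ i" for i using s by (simp add: u_def)
  have U2: "(U i t)\<^sup>2 = (u i)\<^sup>2 / x ^ i" for i
    by (simp add: U x_def power_divide flip: power_mult) (simp add: mult.commute)
  have "fps_to_fls (\<Phi> (pattern_21_3_to k) oo fps_X ^ 2) = g (Suc m)"
    using Phi_eq_gf[of m] by (simp add: k g_def subst_sq_def eval_nat_numeral)
  also have "\<dots> = 2 * x ^ (m + 4) / (u k)\<^sup>2 *
      ((u 2)\<^sup>2 / u 3 + (\<Sum>i=3..k - 1. x ^ (i + 1) / (u i * u (i + 1)) * ((\<Sum>j=1..i. (U j t)\<^sup>2) - 2)))"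
    using sol(2)[of m] by (simp only: k U2) (simp add: eval_nat_numeral)
  also have "\<dots> = 2 * x ^ (m + 4) / (u k)\<^sup>2 * (sqrt_x * ((U 2 t)\<^sup>2 / U 3 t +
      (\<Sum>i=3..k - 1. 1 / (U i t * U (i + 1) t) * ((\<Sum>j=1..i. (U j t)\<^sup>2) - 2))))"
  proof -
    \<comment> \<open>Both kinds of terms scale by one power of \<open>sqrt_x\<close>: the exponents
      are \<open>4 - 3\<close> for the first and \<open>2 * (i + 1) - (2 * i + 1)\<close> for the
      summands.\<close>
    have "(u 2)\<^sup>2 / u 3 = sqrt_x * ((U 2 t)\<^sup>2 / U 3 t)"
      using s sol(1)[of 3] by (simp add: u_def field_simps power2_eq_square power3_eq_cube)
    moreover have "x ^ (i + 1) / (u i * u (i + 1)) = sqrt_x * (1 / (U i t * U (i + 1) t))" for i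
      using s sol(1)[of i] sol(1)[of "i + 1"]
      by (simp add: u_def field_simps x_def power2_eq_square power_mult_distrib)
    ultimately show ?thesis by (simp only: sum_distrib_left distrib_left mult.assoc)
  qed
  also have "2 * x ^ (m + 4) / (u k)\<^sup>2 * (sqrt_x * y) = 1 / (4 * t ^ 3 * (U k t)\<^sup>2) * y" for y
  proof -
    have "1 / (4 * t ^ 3 * (U k t)\<^sup>2) = 2 * sqrt_x ^ 3 * x ^ k / (u k)\<^sup>2"
    proof -
      have "1 / (4 * t ^ 3) = 2 * sqrt_x ^ 3"
        using s unfolding assms(3) by (simp add: field_simps power3_eq_cube)
      then have "1 / (4 * t ^ 3 * (U k t)\<^sup>2) = 2 * sqrt_x ^ 3 / (U k t)\<^sup>2"
        by (metis divide_divide_eq_left)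
      then show ?thesis by (simp add: U2)
    qed
    \<comment> \<open>With \<open>k = m + 3\<close> both sides are \<open>sqrt_x\<close> to the
      power \<open>2 * m + 9\<close>.\<close>
    moreover have "sqrt_x ^ 3 * x ^ k = x ^ (m + 4) * sqrt_x"
      by (simp add: k x_def power_add power2_eq_square power3_eq_cube power4_eq_xxxx)
    ultimately have "2 * x ^ (m + 4) / (u k)\<^sup>2 * sqrt_x = 1 / (4 * t ^ 3 * (U k t)\<^sup>2)"
      by (simp add: mult.assoc)
    then show ?thesis by (simp only: mult.assoc[symmetric])
  qed
  finally show ?thesis .
qed

end
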